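(* Let $\Omega\subseteq\mathbb{R}^N$ be a nonempty open subset, let $0<m<1$, and let $(a,\boldsymbol{b},c)\in\mathbb{R}\times\mathbb{C}\times\mathbb{R}$ with $a>0$, $\Re(\boldsymbol{b})\ge0$ and $c\ge0$. Then for every $\boldsymbol{F}\in L^2(\Omega)$, the equation $$-\Delta\boldsymbol{U}-\mathrm{i}a|\boldsymbol{U}|^{-(1-m)}\boldsymbol{U}-\mathrm{i}\boldsymbol{b}\boldsymbol{U}+\mathrm{i}c\,x\cdot\nabla\boldsymbol{U}=\boldsymbol{F}\quad\text{in }\mathscr{D}'(\Omega)$$ admits at most one global very weak solution $\boldsymbol{U}\in L^2_c(\Omega)$ (i.e. with compact support in $\Omega$).
   Context: All functions are complex-valued; $|\boldsymbol{z}|^{-(1-m)}\boldsymbol{z}:=0$ when $\boldsymbol{z}=0$. $L^2_c(\Omega)$ is the set of $L^2(\Omega)$ functions whose support is a compact subset of $\Omega$. A global very weak solution is a function $\boldsymbol{U}\in L^2(\Omega)$ such that for all $\boldsymbol{\varphi}\in\mathscr{D}(\Omega)$, $\langle\boldsymbol{U},-\Delta\boldsymbol{\varphi}\rangle+\langle -\mathrm{i}a|\boldsymbol{U}|^{-(1-m)}\boldsymbol{U}-\mathrm{i}\boldsymbol{b}\boldsymbol{U}+\mathrm{i}c\,x\cdot\nabla\boldsymbol{U},\boldsymbol{\varphi}\rangle=\langle\boldsymbol{F},\boldsymbol{\varphi}\rangle$, where $\langle\cdot,\cdot\rangle$ is the real part of the distributional pairing $\Re\,\langle T,\overline{\boldsymbol{\varphi}}\rangle$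 and $x\cdot\nabla\boldsymbol{U}$ is understood in the sense of distributions. *)

theory Defs
  imports "HOL-Analysis.Analysis"
begin

definition pderiv_c :: "'n::finite \<Rightarrow> (real^'n \<Rightarrow> complex) \<Rightarrow> real^'n \<Rightarrow> complex" where
  "pderiv_c i f x = frechet_derivative f (at x) (axis i 1)"

coinductive smooth_c :: "(real^'n::finite \<Rightarrow> complex) \<Rightarrow> bool" where
  "(\<forall>x. f differentiable (at x)) \<Longrightarrow> (\<forall>i. smooth_c (pderiv_c i f)) \<Longrightarrow> smooth_c f"

definition test_fun :: "(real^'n::finite) set \<Rightarrow> (real^'n \<Rightarrow> complex) \<Rightarrow> bool" where
  "test_fun \<Omega> \<phi> \<longleftrightarrow> smooth_c \<phi> \<and> compact (closure {x. \<phi> x \<noteq> 0})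
      \<and> closure {x. \<phi> x \<noteq> 0} \<subseteq> \<Omega>"

definition laplacian_c :: "(real^'n::finite \<Rightarrow> complex) \<Rightarrow> real^'n \<Rightarrow> complex" where
  "laplacian_c f x = (\<Sum>i\<in>UNIV. pderiv_c i (pderiv_c i f) x)"

definition radial_deriv_c :: "(real^'n::finite \<Rightarrow> complex) \<Rightarrow> real^'n \<Rightarrow> complex" where
  "radial_deriv_c f x = (\<Sum>i\<in>UNIV. complex_of_real (x $ i) * pderiv_c i f x)"

definition nonlin :: "real \<Rightarrow> complex \<Rightarrow> complex" where
  "nonlin m z = (if z = 0 then 0 else complex_of_real (cmod z powr (-(1 - m))) * z)"

definition L2_on :: "(real^'n::finite) set \<Rightarrow> (real^'n \<Rightarrow> complex) \<Rightarrow> bool" where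
  "L2_on \<Omega> U \<longleftrightarrow> U \<in> borel_measurable (lebesgue_on \<Omega>)
      \<and> integrable (lebesgue_on \<Omega>) (\<lambda>x. (cmod (U x))\<^sup>2)"

definition L2c_on :: "(real^'n::finite) set \<Rightarrow> (real^'n \<Rightarrow> complex) \<Rightarrow> bool" where
  "L2c_on \<Omega> U \<longleftrightarrow> L2_on \<Omega> U \<and>
      (\<exists>K. compact K \<and> K \<subseteq> \<Omega> \<and> (AE x in lebesgue_on \<Omega>. x \<notin> K \<longrightarrow> U x = 0))"

text \<open>Global very weak solution. The pairing is Re of the distributional pairing with conj phi;
  the distribution x . grad U acts by <x . grad U, psi> = - int U (N psi + x . grad psi).\<close>
definition very_weak_solution ::
  "(real^'n::finite) set \<Rightarrow> real \<Rightarrow> real \<Rightarrow> complex \<Rightarrow> real \<Rightarrow> (real^'n \<Rightarrow> complex)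
     \<Rightarrow> (real^'n \<Rightarrow> complex) \<Rightarrow> bool" where
  "very_weak_solution \<Omega> m a b c F U \<longleftrightarrow> L2_on \<Omega> U \<and>
    (\<forall>\<phi>. test_fun \<Omega> \<phi> \<longrightarrow>
      Re (LINT x|lebesgue_on \<Omega>. U x * cnj (- laplacian_c \<phi> x))
      + Re (LINT x|lebesgue_on \<Omega>.
              (- \<i> * complex_of_real a * nonlin m (U x) - \<i> * b * U x) * cnj (\<phi> x))
      + Re (\<i> * complex_of_real c *
              (- (LINT x|lebesgue_on \<Omega>.
                    U x * cnj (of_nat CARD('n) * \<phi> x + radial_deriv_c \<phi> x))))
      = Re (LINT x|lebesgue_on \<Omega>. F x * cnj (\<phi> x)))"

end

theory Submission
  imports Defs "HOL-Computational_Algebra.Polynomial"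
begin

text \<open>The difference \<open>u\<close> of two solutions satisfies the equation with the nonlinearity replaced by the
  difference \<open>g\<close> of the two nonlinear terms. For smooth \<open>u\<close> one would test with \<open>\<i> u\<close>: the Laplacian
  drops out, the dilation term gives \<open>c N / 2 \<parallel>u\<parallel>\<^sup>2\<close>, and so
  \<open>a Re \<integral> g cnj u + (Re b + c N / 2) \<parallel>u\<parallel>\<^sup>2 = 0\<close>, where the first integrand is positive wherever
  \<open>u \<noteq> 0\<close>. As \<open>u\<close> is merely square integrable, the equation is instead tested with an even bump
  \<open>\<rho> ((x - \<cdot>) / e)\<close> centred at a point \<open>x\<close> of the support, multiplied by \<open>cnj (u x)\<close> and integrated over
  \<open>x\<close>. All double integrals then depend only on correlations \<open>h \<mapsto> \<integral> v (x - h) cnj (u x) dx\<close>, which are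
  continuous at \<open>0\<close>, and \<open>e \<rightarrow> 0\<close> gives the identity above.\<close>

section \<open>Bump functions\<close>

text \<open>Testing leaves factors \<open>1 / e^2\<close> and \<open>1 / e\<close>, whose limits
  cannot be controlled for merely square integrable \<open>u\<close>. Both are removed exactly, for
  every \<open>e\<close>: the averaged Laplacian term is real because its kernel is even, so taking
  imaginary parts deletes it, and symmetrizing the dilation term in its two variables produces a
  factor \<open>e\<close> that cancels the denominator.

  Using one explicit bump per centre, rather than a single test function built from
  \<open>u\<close>, means that smoothness is verified for explicit functions only; the integration
  over the centres happens afterwards, in the equation. Complex weights on the bumps recover a
  complex equation from its real part, which is what permits the multiplication by
  \<open>cnj (u x)\<close>. Compactness of the support gives one range of \<open>e\<close> for which
  all bumps fit into \<Omega>.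

  The coefficient \<open>c N / 2\<close> is \<open>c N - c N / 2\<close>: the zero-order part of the
  dilation term gives \<open>c N\<close>, and each of the \<open>N\<close> first moments of a
  differentiated bump equals minus the mass of the bump and contributes
  \<open>- c / 2\<close>.\<close>

definition flat_exp :: "nat \<Rightarrow> real \<Rightarrow> real" where
  "flat_exp k s = (if s \<le> 0 then 0 else exp (- 1 / s) / s ^ k)"

lemma flat_exp_Suc: "s * flat_exp (Suc k) s = flat_exp k s"
  by (simp add: flat_exp_def)

text \<open>The index \<open>k\<close> counts the powers of \<open>1 / s\<close> that
  differentiation creates, so the family is closed under it. Only \<open>s = 0\<close> is delicate:
  there the claimed derivative is \<open>0\<close>, and \<open>exp (- 1 / s)\<close> has to beat
  every power of \<open>1 / s\<close>.\<close>

lemma DERIV_flat_exp: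
  "(flat_exp k has_real_derivative (flat_exp (k + 2) s - real k * flat_exp (k + 1) s)) (at s)"
proof -
  consider "s < 0" | "s = 0" | "s > 0" by linarith
  then show ?thesis
  proof cases
    case 1
    have "((\<lambda>_. 0) has_real_derivative 0) (at s)" by simp
    then have "(flat_exp k has_real_derivative 0) (at s)"
      by (rule DERIV_cong_ev[THEN iffD2, rotated -1, OF _ refl])
        (use 1 in \<open>auto simp: flat_exp_def eventually_at_filter eventually_nhds intro!: exI[of _ "{..<0}"]\<close>)
    then show ?thesis using 1 by (simp add: flat_exp_def)
  next
    case 2
    \<comment> \<open>With \<open>t = 1 / y\<close> the right-hand difference quotient
      \<open>flat_exp k y / y\<close> becomes this expression; the exponent \<open>Suc k\<close>
      accounts for the division by \<open>y\<close>.\<close>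
    have "((\<lambda>t. t ^ Suc k / exp t) \<longlongrightarrow> (0::real)) at_top"
      by (rule tendsto_power_div_exp_0)
    then have "((\<lambda>y. inverse y ^ Suc k / exp (inverse y)) \<longlongrightarrow> (0::real)) (at_right 0)"
      by (rule filterlim_compose[OF _ filterlim_inverse_at_top_right])
    then have r: "((\<lambda>y. flat_exp k y / y) \<longlongrightarrow> 0) (at_right 0)"
      by (rule Lim_transform_eventually)
        (auto simp: flat_exp_def eventually_at_filter exp_minus field_simps)
    have l: "((\<lambda>y. flat_exp k y / y) \<longlongrightarrow> 0) (at_left 0)"
      by (rule tendsto_eventually) (auto simp: flat_exp_def eventually_at_filter)
    have "((\<lambda>y. flat_exp k y / y) \<longlongrightarrow> 0) (at 0)"
      using r l by (simp add: filterlim_split_at)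
    then have "(flat_exp k has_real_derivative 0) (at 0)"
      by (simp add: has_field_derivative_iff flat_exp_def)
    then show ?thesis using 2 by (simp add: flat_exp_def)
  next
    case 3
    have "((\<lambda>s. exp (- 1 / s) / s ^ k) has_real_derivative
       (exp (- 1 / s) / s ^ (k + 2) - real k * (exp (- 1 / s) / s ^ (k + 1)))) (at s)"
      using 3
      by (cases k) (auto intro!: derivative_eq_intros simp: divide_simps power2_eq_square,
        simp_all add: algebra_simps power2_eq_square,
        metis One_nat_def power_eq_if)
    then have "(flat_exp k has_real_derivative
       (exp (- 1 / s) / s ^ (k + 2) - real k * (exp (- 1 / s) / s ^ (k + 1)))) (at s)"
      by (rule DERIV_cong_ev[THEN iffD2, rotated -1, OF _ refl])
        (use 3 in \<open>auto simp: flat_exp_def eventually_nhds intro!: exI[of _ "{0<..}"]\<close>)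
    then show ?thesis using 3 by (simp add: flat_exp_def)
  qed
qed

text \<open>With \<open>s = 1 - t^2\<close>, write the \<open>j\<close>-th derivative of
  \<open>exp (- 1 / s)\<close> as \<open>P s^(-2j) exp (- 1 / s)\<close>. Differentiating and
  extracting \<open>s^(-2j-2)\<close> leaves \<open>P' s^2 - 2 t P (1 - 2 j s)\<close>; the literal
  \<open>[:1, 0, -1:]\<close> is \<open>s\<close>.\<close>

fun bump_poly :: "nat \<Rightarrow> real poly" where
  "bump_poly 0 = 1"
| "bump_poly (Suc j) = pderiv (bump_poly j) * [:1, 0, -1:] ^ 2
     - [:0, 2:] * bump_poly j * (1 - smult (2 * real j) [:1, 0, -1:])"

text \<open>The \<open>j\<close>-th derivative of \<open>exp (- 1 / (1 - t\<^sup>2))\<close>, extended by \<open>0\<close> outside \<open>(-1, 1)\<close>.\<close>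
definition bump :: "nat \<Rightarrow> real \<Rightarrow> real" where
  "bump j t = poly (bump_poly j) t * flat_exp (2 * j) (1 - t\<^sup>2)"

lemma DERIV_bump: "(bump j has_real_derivative bump (Suc j) t) (at t)"
proof -
  define s where "s = 1 - t\<^sup>2"
  define e where "e = flat_exp (2 * j + 2) s"
  \<comment> \<open>All three powers are multiples of the highest one, also where
    \<open>s \<le> 0\<close>, so the claim becomes the polynomial recursion times
    \<open>e\<close>.\<close>
  have e1: "flat_exp (2 * j + 1) s = s * e" and e0: "flat_exp (2 * j) s = s\<^sup>2 * e"
    using flat_exp_Suc[of s "2 * j + 1"] flat_exp_Suc[of s "2 * j"]
    unfolding e_def power2_eq_square by (simp_all add: mult.assoc)
  have "(bump j has_real_derivative
      (poly (pderiv (bump_poly j)) t * flat_exp (2 * j) s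
       + (flat_exp (2 * j + 2) s - real (2 * j) * flat_exp (2 * j + 1) s) * (- 2 * t)
         * poly (bump_poly j) t)) (at t)"
    unfolding bump_def [abs_def] s_def
    by (rule derivative_eq_intros DERIV_chain2[OF DERIV_flat_exp] poly_DERIV refl | simp)+
  also have "poly (pderiv (bump_poly j)) t * flat_exp (2 * j) s
       + (flat_exp (2 * j + 2) s - real (2 * j) * flat_exp (2 * j + 1) s) * (- 2 * t)
         * poly (bump_poly j) t = bump (Suc j) t"
    unfolding e1 e0 by (simp add: bump_def e_def s_def algebra_simps power2_eq_square)
  finally show ?thesis .
qed

lemma continuous_on_bump: "continuous_on A (bump j)"
  by (meson DERIV_bump DERIV_isCont continuous_at_imp_continuous_on)

lemma bump_eq_0: "\<bar>t\<bar> \<ge> 1 \<Longrightarrow> bump j t = 0"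
proof -
  assume "\<bar>t\<bar> \<ge> 1"
  then have "1 \<le> t\<^sup>2" using abs_le_square_iff[of 1 t] by simp
  then show ?thesis by (simp add: bump_def flat_exp_def)
qed

text \<open>Differentiating the identity for \<open>j\<close> and using uniqueness of derivatives
  gives the one for \<open>Suc j\<close>. This parity makes the Laplacian kernel even and the
  gradient kernel odd.\<close>

lemma bump_minus: "bump j (- t) = (- 1) ^ j * bump j t"
proof (induction j arbitrary: t)
  case (Suc j)
  have "((\<lambda>t. bump j (- t)) has_real_derivative (bump (Suc j) (- t) * (- 1))) (at t)"
    by (rule DERIV_chain2[OF DERIV_bump]) (auto intro!: derivative_eq_intros)
  moreover have "((\<lambda>t. bump j (- t)) has_real_derivative ((- 1) ^ j * bump (Suc j) t)) (at t)"
    unfolding Suc by (rule DERIV_cmult[OF DERIV_bump])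
  ultimately have "bump (Suc j) (- t) * (- 1) = (- 1) ^ j * bump (Suc j) t"
    by (rule DERIV_unique)
  then show ?case by simp
qed (simp add: bump_def)

lemma bump_0_nonneg: "bump 0 t \<ge> 0"
  by (simp add: bump_def flat_exp_def)

lemma bump_0_pos: "bump 0 0 > 0"
  by (simp add: bump_def flat_exp_def)

lemma integrable_continuous_compact_support:
  fixes f :: "'a::euclidean_space \<Rightarrow> 'b::{banach, second_countable_topology}"
  assumes "continuous_on UNIV f" "compact K" "\<And>x. x \<notin> K \<Longrightarrow> f x = 0"
  shows "integrable lborel f"
proof -
  have "set_integrable lborel K f"
    unfolding set_integrable_def
    by (rule borel_integrable_compact) (use assms in \<open>auto intro: continuous_on_subset\<close>)
  moreover have "(\<lambda>x. indicator K x *\<^sub>R f x) = f"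
    using assms(3) by (auto simp: indicator_def)
  ultimately show ?thesis by (simp add: set_integrable_def)
qed

lemma integrable_bump [simp]: "integrable lborel (bump j)"
  by (rule integrable_continuous_compact_support[where K = "{-1..1}"])
    (auto intro: continuous_on_bump bump_eq_0)

text \<open>A nonnegative function with integral \<open>0\<close> vanishes almost everywhere, but
  the set where this bump is nonzero is open and nonempty, hence not null.\<close>

lemma integral_bump_0_pos: "(LINT t|lborel. bump 0 t) > 0"
proof -
  have "(LINT t|lborel. bump 0 t) \<noteq> 0"
  proof
    assume "(LINT t|lborel. bump 0 t) = 0"
    then have "AE t in lborel. bump 0 t = 0"
      by (subst (asm) integral_nonneg_eq_0_iff_AE) (auto simp: bump_0_nonneg)
    moreover have o: "open {t. bump 0 t \<noteq> 0}"
      by (intro open_Collect_neq continuous_on_bump continuous_intros)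
    ultimately have "{t. bump 0 t \<noteq> 0} \<in> null_sets lborel"
      by (subst AE_iff_null_sets) auto
    then have "negligible {t. bump 0 t \<noteq> 0}"
      by (simp add: negligible_iff_null_sets null_sets_completionI)
    with o have "{t. bump 0 t \<noteq> 0} = {}" using open_not_negligible by blast
    then show False using bump_0_pos by auto
  qed
  moreover have "(LINT t|lborel. bump 0 t) \<ge> 0" by (simp add: bump_0_nonneg)
  ultimately show ?thesis by linarith
qed

text \<open>Integration by parts: \<open>t * bump 0 t\<close> is a primitive of
  \<open>bump 0 t + t * bump 1 t\<close> and vanishes at both ends of the support.\<close>

lemma integral_bump_1: "(LINT t|lborel. t * bump 1 t) = - (LINT t|lborel. bump 0 t)"
proof -
  have d: "((\<lambda>t. t * bump 0 t) has_real_derivative (bump 0 t + t * bump 1 t)) (at t)" for t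
    using DERIV_mult[OF DERIV_ident DERIV_bump[of 0]] by (simp add: add.commute mult.commute)
  have i: "integrable lborel (\<lambda>t. t * bump 1 t)"
    by (rule integrable_continuous_compact_support[where K = "{-1..1}"])
      (auto intro!: continuous_intros continuous_on_bump bump_eq_0)
  have "(LINT t|lborel. (bump 0 t + t * bump 1 t) * indicator {-1..1} t)
     = 1 * bump 0 1 - (- 1) * bump 0 (- 1)"
    by (rule integral_FTC_Icc_real[where F = "\<lambda>t. t * bump 0 t"])
     (use d in \<open>auto intro!: continuous_intros DERIV_isCont[OF DERIV_bump]\<close>)
  also have "(\<lambda>t. (bump 0 t + t * bump 1 t) * indicator {-1..1} t) = (\<lambda>t. bump 0 t + t * bump 1 t)"
  proof
    fix t :: real
    have "bump j t = 0" if "t \<notin> {-1..1}" for j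
      using that by (intro bump_eq_0) auto
    then show "(bump 0 t + t * bump 1 t) * indicator {-1..1} t = bump 0 t + t * bump 1 t"
      by (cases "t \<in> {-1..1}") (simp_all del: atLeastAtMost_iff)
  qed
  finally show ?thesis using i by (simp add: bump_eq_0)
qed

text \<open>The partial derivative with multi-index \<open>k\<close> of a tensor product bump function.\<close>

definition mbump :: "('n::finite \<Rightarrow> nat) \<Rightarrow> real^'n \<Rightarrow> real" where
  "mbump k z = (\<Prod>i\<in>UNIV. bump (k i) (z $ i))"

lemma continuous_on_mbump [continuous_intros]:
  "continuous_on A g \<Longrightarrow> continuous_on A (\<lambda>x. mbump k (g x))"
  unfolding mbump_def
  by (intro continuous_intros continuous_on_compose2[OF continuous_on_bump[of UNIV]]) auto

lemma mbump_upd: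
  "mbump (k(i := n)) z = bump n (z $ i) * (\<Prod>j\<in>UNIV - {i}. bump (k j) (z $ j))"
proof -
  have "(\<Prod>j\<in>UNIV - {i}. bump ((k(i := n)) j) (z $ j)) = (\<Prod>j\<in>UNIV - {i}. bump (k j) (z $ j))"
    by (intro prod.cong) auto
  then show ?thesis
    unfolding mbump_def by (subst prod.remove[of UNIV i]) auto
qed

lemma mbump_eq_0: "\<bar>z $ i\<bar> \<ge> 1 \<Longrightarrow> mbump k z = 0"
  unfolding mbump_def by (rule prod_zero) (auto intro: bump_eq_0)

lemma mbump_eq_0_cbox: "z \<notin> cbox (- 1) 1 \<Longrightarrow> mbump k z = 0"
proof -
  assume "z \<notin> cbox (- 1) 1"
  then obtain i where "\<not> (- 1 \<le> z $ i \<and> z $ i \<le> 1)"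
    by (auto simp: mem_box_cart)
  then show ?thesis by (intro mbump_eq_0[of z i]) auto
qed

lemma mbump_minus: "mbump k (- z) = (- 1) ^ (\<Sum>i\<in>UNIV. k i) * mbump k z"
  by (simp add: mbump_def bump_minus prod.distrib power_sum)

lemma mbump_bounded: "\<exists>C. \<forall>z. \<bar>mbump k z\<bar> \<le> C"
proof -
  have "compact (mbump k ` cbox (- 1) 1)"
    by (intro compact_continuous_image continuous_intros compact_cbox)
  then obtain C where C: "\<And>z. z \<in> cbox (- 1) 1 \<Longrightarrow> \<bar>mbump k z\<bar> \<le> C"
    by (fastforce dest!: compact_imp_bounded simp: bounded_iff)
  have "\<bar>mbump k z\<bar> \<le> max C 0" for z
    using C[of z] mbump_eq_0_cbox[of z k] by (cases "z \<in> cbox (- 1) 1") auto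
  then show ?thesis by blast
qed

lemma integrable_mbump:
  fixes f :: "real^'n::finite \<Rightarrow> real"
  assumes "continuous_on UNIV f"
  shows "integrable lborel (\<lambda>z. f z * mbump k z)"
  by (rule integrable_continuous_compact_support[where K = "cbox (- 1) 1"])
    (auto intro!: continuous_intros assms simp: mbump_eq_0_cbox)

text \<open>Fubini. The factors are reindexed from coordinates to basis vectors because
  \<open>lborel\<close> is the image of a product measure indexed by \<open>Basis\<close>.\<close>

lemma integral_prod_cart:
  fixes f :: "'n::finite \<Rightarrow> real \<Rightarrow> real"
  assumes "\<And>i. integrable lborel (f i)"
  shows "(LINT z|lborel. (\<Prod>i\<in>UNIV. f i (z $ i))) = (\<Prod>i\<in>UNIV. (LINT t|lborel. f i t))"
proof -
  interpret product_sigma_finite "\<lambda>_. lborel :: real measure" ..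
  define g :: "real^'n \<Rightarrow> real \<Rightarrow> real" where "g b = f (axis_index b)" for b
  have gi: "g (axis i 1) = f i" for i by (simp add: g_def axis_index_axis)
  have B: "(Basis :: (real^'n) set) = (\<lambda>i. axis i 1) ` UNIV"
    by (auto simp: Basis_vec_def)
  have inj: "inj (\<lambda>i::'n. axis i (1::real))" by (auto simp: inj_on_def axis_eq_axis)
  have [measurable]: "f i \<in> borel_measurable borel" for i
    using assms[of i] by auto
  have p: "(\<Prod>i\<in>UNIV. h (axis i 1)) = (\<Prod>b\<in>Basis. h b)" for h :: "real^'n \<Rightarrow> real"
    unfolding B by (simp add: prod.reindex inj)
  have "(LINT z|lborel. (\<Prod>i\<in>UNIV. f i (z $ i))) = (LINT z|lborel. (\<Prod>b\<in>Basis. g b (z \<bullet> b)))"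
    unfolding p[symmetric] gi by (simp add: inner_axis)
  also have "\<dots> = (LINT h|Pi\<^sub>M Basis (\<lambda>b. lborel). (\<Prod>b\<in>Basis. g b ((\<Sum>b\<in>Basis. h b *\<^sub>R b) \<bullet> b)))"
    by (subst lborel_eq, subst integral_distr) (simp_all add: g_def)
  also have "\<dots> = (LINT h|Pi\<^sub>M Basis (\<lambda>b. lborel). (\<Prod>b\<in>Basis. g b (h b)))"
    by simp
  also have "\<dots> = (\<Prod>b\<in>Basis. (LINT t|lborel. g b t))"
    by (rule product_integral_prod) (auto simp: g_def assms)
  also have "\<dots> = (\<Prod>i\<in>UNIV. (LINT t|lborel. f i t))"
    unfolding p[symmetric] gi ..
  finally show ?thesis .
qed

lemma integral_mbump_0_pos: "(LINT z|lborel. mbump (\<lambda>_::'n::finite. 0) z) > 0"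
  unfolding mbump_def
  by (subst integral_prod_cart) (auto intro: zero_less_power integral_bump_0_pos)

text \<open>The weight and the derivative both sit in factor \<open>i\<close>, where the
  one-dimensional moment supplies the sign; all other factors are those of the undifferentiated
  bump.\<close>

lemma integral_mbump_1:
  "(LINT z|lborel. z $ i * mbump ((\<lambda>_::'n::finite. 0)(i := 1)) z)
    = - (LINT z|lborel. mbump (\<lambda>_::'n. 0) z)"
proof -
  define f :: "'n \<Rightarrow> real \<Rightarrow> real" where "f = (\<lambda>_. bump 0)(i := (\<lambda>t. t * bump 1 t))"
  have i: "integrable lborel (\<lambda>t. t * bump 1 t)"
    by (rule integrable_continuous_compact_support[where K = "{-1..1}"])
      (auto intro!: continuous_intros continuous_on_bump bump_eq_0)
  have "z $ i * mbump ((\<lambda>_. 0)(i := 1)) z = (\<Prod>j\<in>UNIV. f j (z $ j))" for z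
  proof -
    have "(\<Prod>j\<in>UNIV - {i}. f j (z $ j)) = (\<Prod>j\<in>UNIV - {i}. bump 0 (z $ j))"
      by (intro prod.cong) (auto simp: f_def)
    then show ?thesis
      unfolding mbump_upd by (subst prod.remove[of UNIV i]) (auto simp: f_def)
  qed
  then have "(LINT z|lborel. z $ i * mbump ((\<lambda>_. 0)(i := 1)) z) = (\<Prod>j\<in>UNIV. (LINT t|lborel. f j t))"
    using i by (simp only:) (rule integral_prod_cart, auto simp: f_def)
  also have "\<dots> = - (\<Prod>j\<in>(UNIV::'n set). (LINT t|lborel. bump 0 t))"
  proof -
    have "(\<Prod>j\<in>UNIV - {i}. (LINT t|lborel. f j t)) = (\<Prod>j\<in>UNIV - {i}. (LINT t|lborel. bump 0 t))"
      by (intro prod.cong) (auto simp: f_def)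
    moreover have "(LINT t|lborel. f i t) = - (LINT t|lborel. bump 0 t)"
      using integral_bump_1 by (simp add: f_def)
    ultimately show ?thesis
      by (subst (1 2) prod.remove[of UNIV i]) (simp_all del: prod_constant)
  qed
  also have "\<dots> = - (LINT z|lborel. mbump (\<lambda>_::'n. 0) z)"
    unfolding mbump_def by (subst integral_prod_cart) auto
  finally show ?thesis .
qed

section \<open>Rescaled bumps as test functions\<close>

text \<open>The centre is \<open>x\<close> and the variable is \<open>y\<close>, so each derivative
  brings out \<open>- 1 / e\<close>. The complex weight \<open>w\<close> absorbs this factor and
  thus keeps the family closed under partial derivatives.\<close>

definition scaled_mbump :: "complex \<Rightarrow> real \<Rightarrow> real^'n \<Rightarrow> ('n::finite \<Rightarrow> nat) \<Rightarrow> real^'n \<Rightarrow> complex" where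
  "scaled_mbump w e x k y = w * of_real (mbump k ((x - y) /\<^sub>R e))"

lemma has_derivative_scaled_mbump:
  fixes x :: "real^'n::finite"
  shows "(scaled_mbump w e x k has_derivative
    (\<lambda>h. \<Sum>i\<in>UNIV. of_real (h $ i) * scaled_mbump (- w / e) e x (k(i := Suc (k i))) y)) (at y)"
proof -
  have "((\<lambda>y. bump (k i) (((x - y) /\<^sub>R e) $ i)) has_derivative
      (\<lambda>h. - (h $ i) / e * bump (Suc (k i)) (((x - y) /\<^sub>R e) $ i))) (at y)" for i
  proof -
    have "((\<lambda>y. ((x - y) /\<^sub>R e) $ i) has_derivative (\<lambda>h. - (h $ i) / e)) (at y)"
      by (auto intro!: derivative_eq_intros bounded_linear_imp_has_derivative bounded_linear_vec_nth
          simp: divide_inverse_commute)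
    from has_derivative_compose[OF this DERIV_bump[unfolded has_field_derivative_def]]
    show ?thesis by (simp add: mult.commute)
  qed
  then have "((\<lambda>y. mbump k ((x - y) /\<^sub>R e)) has_derivative
      (\<lambda>h. \<Sum>i\<in>UNIV. (- (h $ i) / e * bump (Suc (k i)) (((x - y) /\<^sub>R e) $ i))
        * (\<Prod>j\<in>UNIV - {i}. bump (k j) (((x - y) /\<^sub>R e) $ j)))) (at y)"
    unfolding mbump_def by (intro has_derivative_prod) auto
  also have "(\<lambda>h. \<Sum>i\<in>UNIV. (- (h $ i) / e * bump (Suc (k i)) (((x - y) /\<^sub>R e) $ i))
        * (\<Prod>j\<in>UNIV - {i}. bump (k j) (((x - y) /\<^sub>R e) $ j)))
     = (\<lambda>h. \<Sum>i\<in>UNIV. - (h $ i) / e * mbump (k(i := Suc (k i))) ((x - y) /\<^sub>R e))"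
    unfolding mbump_upd by (simp add: mult.assoc)
  finally have "((\<lambda>y. w * of_real (mbump k ((x - y) /\<^sub>R e))) has_derivative
      (\<lambda>h. w * of_real (\<Sum>i\<in>UNIV. - (h $ i) / e * mbump (k(i := Suc (k i))) ((x - y) /\<^sub>R e)))) (at y)"
    by (intro has_derivative_mult_right has_derivative_of_real)
  also have "(\<lambda>h. w * of_real (\<Sum>i\<in>UNIV. - (h $ i) / e * mbump (k(i := Suc (k i))) ((x - y) /\<^sub>R e)))
     = (\<lambda>h. \<Sum>i\<in>UNIV. of_real (h $ i) * scaled_mbump (- w / e) e x (k(i := Suc (k i))) y)"
    by (simp add: scaled_mbump_def sum_distrib_left mult_ac)
  finally show ?thesis
    by (simp add: scaled_mbump_def [abs_def])
qed

lemma pderiv_scaled_mbump: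
  "pderiv_c i (scaled_mbump w e x k) = scaled_mbump (- w / e) e x (k(i := Suc (k i)))"
proof
  fix y
  have "pderiv_c i (scaled_mbump w e x k) y
     = (\<Sum>j\<in>UNIV. of_real ((axis i 1 :: real^'a) $ j) * scaled_mbump (- w / e) e x (k(j := Suc (k j))) y)"
    unfolding pderiv_c_def
    by (subst frechet_derivative_at[OF has_derivative_scaled_mbump, symmetric]) simp
  also have "\<dots> = (\<Sum>j\<in>UNIV. if j = i then scaled_mbump (- w / e) e x (k(j := Suc (k j))) y else 0)"
    by (intro sum.cong) (auto simp: axis_def)
  finally show "pderiv_c i (scaled_mbump w e x k) y = scaled_mbump (- w / e) e x (k(i := Suc (k i))) y"
    by simp
qed

text \<open>Coinduction with the invariant of being a scaled bump with the given \<open>e\<close>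
  and \<open>x\<close> but arbitrary weight and multi-index: such functions are differentiable, and
  their partial derivatives are again of this form.\<close>

lemma smooth_scaled_mbump: "smooth_c (scaled_mbump w e x k)"
proof -
  have "smooth_c f" if "\<exists>w k. f = scaled_mbump w e x k" for f
    using that
  proof (coinduction arbitrary: f)
    case smooth_c
    then obtain w k where "f = scaled_mbump w e x k" by blast
    moreover have "f differentiable at y" for y
      using calculation has_derivative_scaled_mbump differentiable_def by blast
    ultimately show ?case by (auto simp: pderiv_scaled_mbump)
  qed
  then show ?thesis by blast
qed

lemma scaled_mbump_support:
  fixes x :: "real^'n::finite" and e :: real
  assumes "e > 0"
  shows "closure {y. scaled_mbump w e x k y \<noteq> 0} \<subseteq> cball x (e * CARD('n))"
proof (rule closure_minimal)
  show "{y. scaled_mbump w e x k y \<noteq> 0} \<subseteq> cball x (e * CARD('n))"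
  proof safe
    fix y assume "scaled_mbump w e x k y \<noteq> 0"
    then have "\<bar>((x - y) /\<^sub>R e) $ i\<bar> < 1" for i
      using mbump_eq_0[of "(x - y) /\<^sub>R e" i k] by (force simp: scaled_mbump_def)
    then have "\<bar>(x - y) $ i\<bar> \<le> e" for i
      using assms by (force simp: abs_mult field_simps intro: less_imp_le)
    \<comment> \<open>The support is a cube of half side \<open>e\<close>; bounding the Euclidean
      norm by the sum of the coordinates is the origin of the radius
      \<open>e * CARD('n)\<close>.\<close>
    then have "norm (x - y) \<le> (\<Sum>i\<in>(UNIV::'n set). e)"
      by (intro order_trans[OF norm_le_l1_cart] sum_mono)
    then show "y \<in> cball x (e * CARD('n))" by (simp add: dist_norm mult.commute)
  qed
qed simp

lemma test_fun_scaled_mbump: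
  fixes x :: "real^'n::finite" and e :: real
  assumes "e > 0" "cball x (e * CARD('n)) \<subseteq> \<Omega>"
  shows "test_fun \<Omega> (scaled_mbump w e x k)"
proof -
  note supp = scaled_mbump_support[OF assms(1), of w x k]
  have "compact (closure {y. scaled_mbump w e x k y \<noteq> 0})"
    using supp bounded_subset[OF bounded_cball] by (simp add: compact_eq_bounded_closed)
  then show ?thesis
    using supp assms(2) by (auto simp: test_fun_def smooth_scaled_mbump)
qed

lemma laplacian_scaled_mbump:
  "laplacian_c (scaled_mbump w e x (\<lambda>_. 0)) y
     = w / e\<^sup>2 * of_real (\<Sum>i\<in>UNIV. mbump ((\<lambda>_. 0)(i := 2)) ((x - y) /\<^sub>R e))"
  by (simp add: laplacian_c_def pderiv_scaled_mbump scaled_mbump_def sum_distrib_left power2_eq_square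
      flip: numeral_2_eq_2)

lemma radial_deriv_scaled_mbump:
  "radial_deriv_c (scaled_mbump w e x (\<lambda>_. 0)) y
     = - w / e * of_real (\<Sum>i\<in>UNIV. y $ i * mbump ((\<lambda>_. 0)(i := 1)) ((x - y) /\<^sub>R e))"
  by (simp add: radial_deriv_c_def pderiv_scaled_mbump scaled_mbump_def sum_distrib_left mult_ac
      sum_negf)

section \<open>Correlations of square integrable functions\<close>

lemma borel_measurable_cnj [measurable]: "cnj \<in> borel_measurable borel"
  by (intro borel_measurable_continuous_onI continuous_intros)

lemma lborel_integral_affine:
  fixes f :: "'a::euclidean_space \<Rightarrow> 'b::{banach, second_countable_topology}"
  assumes "c \<noteq> 0" and [measurable]: "f \<in> borel_measurable borel"
  shows "(LINT x|lborel. f x) = \<bar>c\<bar> ^ DIM('a) *\<^sub>R (LINT x|lborel. f (t + c *\<^sub>R x))"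
  by (subst lborel_affine[OF assms(1), of t]) (simp add: integral_density integral_distr)

lemma lborel_integrable_affine:
  fixes f :: "'a::euclidean_space \<Rightarrow> 'b::{banach, second_countable_topology}"
  assumes "c \<noteq> 0" and f: "integrable lborel f"
  shows "integrable lborel (\<lambda>x. f (t + c *\<^sub>R x))"
proof -
  have [measurable]: "f \<in> borel_measurable borel" using f by auto
  have "integrable (density (distr lborel borel (\<lambda>x. t + c *\<^sub>R x)) (\<lambda>_. \<bar>c\<bar> ^ DIM('a))) f"
    using f by (subst (asm) lborel_affine[OF assms(1), of t]) simp
  then have "integrable lborel (\<lambda>x. \<bar>c\<bar> ^ DIM('a) *\<^sub>R f (t + c *\<^sub>R x))"
    by (simp add: integrable_density integrable_distr_eq)
  from integrable_scaleR_right[OF this, of "inverse (\<bar>c\<bar> ^ DIM('a))"] show ?thesis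
    using assms(1) by simp
qed

definition square_integrable :: "('a::euclidean_space \<Rightarrow> complex) \<Rightarrow> bool" where
  "square_integrable u \<longleftrightarrow> u \<in> borel_measurable borel \<and> integrable lborel (\<lambda>x. (cmod (u x))\<^sup>2)"

lemma square_integrable_measurable [measurable_dest]:
  "square_integrable u \<Longrightarrow> u \<in> borel_measurable borel"
  by (simp add: square_integrable_def)

text \<open>Weighted Young inequality. The free weight \<open>s\<close> stands in for
  Cauchy-Schwarz: it can be tuned so that smallness of one factor outweighs the size of the
  other.\<close>

lemma cmod_mult_le_squares: "s > 0 \<Longrightarrow> cmod (p * q) \<le> s * (cmod p)\<^sup>2 + (cmod q)\<^sup>2 / s"
proof -
  assume s: "s > 0"
  have "0 \<le> (sqrt s * cmod p - cmod q / sqrt s)\<^sup>2" by simp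
  also have "\<dots> = s * (cmod p)\<^sup>2 + (cmod q)\<^sup>2 / s - 2 * cmod (p * q)"
    using s by (simp add: power2_diff power_mult_distrib power_divide norm_mult)
  finally show ?thesis using norm_ge_zero[of "p * q"] by linarith
qed

lemma square_integrable_shift:
  "square_integrable u \<Longrightarrow> square_integrable (\<lambda>x. u (x - h))"
  using lborel_integrable_affine[of 1 "\<lambda>x. (cmod (u x))\<^sup>2" "- h"]
  by (auto simp: square_integrable_def)

lemma integrable_mult_cnj:
  assumes u: "square_integrable u" and v: "square_integrable v"
  shows "integrable lborel (\<lambda>x. u x * cnj (v x))"
proof (rule Bochner_Integration.integrable_bound)
  show "integrable lborel (\<lambda>x. (cmod (u x))\<^sup>2 + (cmod (v x))\<^sup>2)"
    using u v by (auto simp: square_integrable_def)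
  show "(\<lambda>x. u x * cnj (v x)) \<in> borel_measurable lborel" using u v by measurable
  show "AE x in lborel. norm (u x * cnj (v x)) \<le> norm ((cmod (u x))\<^sup>2 + (cmod (v x))\<^sup>2)"
    using cmod_mult_le_squares[of 1] by (simp add: norm_mult)
qed

definition correlation :: "('a::euclidean_space \<Rightarrow> complex) \<Rightarrow> ('a \<Rightarrow> complex) \<Rightarrow> 'a \<Rightarrow> complex" where
  "correlation u v h = (LINT x|lborel. u (x - h) * cnj (v x))"

lemma correlation_measurable [measurable]:
  assumes [measurable]: "u \<in> borel_measurable borel" "v \<in> borel_measurable borel"
  shows "correlation u v \<in> borel_measurable borel"
  unfolding correlation_def by measurable

lemma integral_shift_square:
  "square_integrable u \<Longrightarrow> (LINT x|lborel. (cmod (u (x - h)))\<^sup>2) = (LINT x|lborel. (cmod (u x))\<^sup>2)"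
  using lborel_integral_affine[of 1 "\<lambda>x. (cmod (u x))\<^sup>2" "- h"]
  by (simp add: square_integrable_measurable)

text \<open>Translations preserve the L2 norm, so the bound is uniform in the shift
  \<open>h\<close>. It serves both as a majorant and, for suitable \<open>s\<close>, as a smallness
  estimate.\<close>

lemma correlation_bound:
  assumes u: "square_integrable u" and v: "square_integrable v" and "s > 0"
  shows "cmod (correlation u v h)
    \<le> s * (LINT x|lborel. (cmod (u x))\<^sup>2) + (LINT x|lborel. (cmod (v x))\<^sup>2) / s"
proof -
  note uh = square_integrable_shift[OF u, of h]
  have "cmod (correlation u v h) \<le> (LINT x|lborel. cmod (u (x - h) * cnj (v x)))"
    unfolding correlation_def by (rule integral_norm_bound)
  also have "\<dots> \<le> (LINT x|lborel. s * (cmod (u (x - h)))\<^sup>2 + (cmod (v x))\<^sup>2 / s)"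
    using uh v integrable_norm[OF integrable_mult_cnj[OF uh v]] cmod_mult_le_squares[OF \<open>s > 0\<close>]
    by (intro integral_mono) (auto simp: square_integrable_def norm_mult)
  also have "\<dots> = s * (LINT x|lborel. (cmod (u x))\<^sup>2) + (LINT x|lborel. (cmod (v x))\<^sup>2) / s"
    using uh v by (simp add: integral_shift_square[OF u] square_integrable_def)
  finally show ?thesis .
qed

section \<open>Continuity of correlations at the zero shift\<close>

text \<open>For \<open>M > 0\<close>, the radial retraction onto the closed disc of radius
  \<open>M\<close>; the form with \<open>max\<close> makes its continuity visible without a case
  split.\<close>

definition clamp_norm :: "real \<Rightarrow> complex \<Rightarrow> complex" where
  "clamp_norm M z = of_real (M / max M (cmod z)) * z"

lemma clamp_norm_le: "M > 0 \<Longrightarrow> cmod (clamp_norm M z) \<le> M"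
  by (auto simp: clamp_norm_def norm_mult norm_divide field_simps max_def)

lemma clamp_norm_id: "M > 0 \<Longrightarrow> cmod z \<le> M \<Longrightarrow> clamp_norm M z = z"
  by (simp add: clamp_norm_def max_def)

lemma clamp_norm_diff_le: "M > 0 \<Longrightarrow> cmod (z - clamp_norm M z) \<le> cmod z"
proof -
  assume M: "M > 0"
  have "z - clamp_norm M z = of_real (1 - M / max M (cmod z)) * z"
    by (simp add: clamp_norm_def algebra_simps)
  then have "cmod (z - clamp_norm M z) = \<bar>1 - M / max M (cmod z)\<bar> * cmod z"
    by (simp only: norm_mult norm_of_real)
  also have "\<dots> \<le> 1 * cmod z"
  proof (intro mult_right_mono)
    have "0 \<le> M / max M (cmod z)" "M / max M (cmod z) \<le> 1"
      using M by auto
    then show "\<bar>1 - M / max M (cmod z)\<bar> \<le> 1" by linarith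
  qed simp
  finally show ?thesis by simp
qed

lemma isCont_clamp_norm: "M > 0 \<Longrightarrow> isCont (clamp_norm M) z"
  unfolding clamp_norm_def by (intro continuous_intros) auto

text \<open>Truncating \<open>u\<close> at a large height costs little in L2. On \<open>B\<close>,
  which has finite measure, uniformly bounded almost everywhere convergence to the truncation is
  also L2 convergence.\<close>

lemma continuous_approx_L2:
  fixes u :: "'a::euclidean_space \<Rightarrow> complex"
  assumes u: "square_integrable u" and "e > 0" and B: "compact B"
  obtains w M where "continuous_on UNIV w" "\<And>x. cmod (w x) \<le> M"
    "(LINT x|lborel. indicator B x * (cmod (u x - w x))\<^sup>2) < e"
proof -
  have [measurable]: "u \<in> borel_measurable borel" "B \<in> sets borel"
    using u B by (auto simp: borel_compact)
  have fB: "integrable lborel (indicator B :: 'a \<Rightarrow> real)"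
    using emeasure_compact_finite[OF B] by (simp add: less_top[symmetric])
  have iu: "integrable lborel (\<lambda>x. (cmod (u x))\<^sup>2)" using u by (simp add: square_integrable_def)
  have cm [measurable]: "clamp_norm M \<in> borel_measurable borel" for M
    unfolding clamp_norm_def by measurable
  have "(\<lambda>n. LINT x|lborel. (cmod (u x - clamp_norm (real (Suc n)) (u x)))\<^sup>2) \<longlonglongrightarrow> (LINT x|(lborel :: 'a measure). (0::real))"
  proof (rule integral_dominated_convergence[where w = "\<lambda>x. (cmod (u x))\<^sup>2"])
    show "AE x in lborel. (\<lambda>n. (cmod (u x - clamp_norm (real (Suc n)) (u x)))\<^sup>2) \<longlonglongrightarrow> 0"
    proof (intro AE_I2 tendsto_eventually)
      fix x
      obtain N where "cmod (u x) \<le> real N" using real_arch_simple by blast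
      then show "\<forall>\<^sub>F n in sequentially. (cmod (u x - clamp_norm (real (Suc n)) (u x)))\<^sup>2 = 0"
        by (intro eventually_sequentiallyI[of N]) (simp add: clamp_norm_id)
    qed
    show "AE x in lborel. norm ((cmod (u x - clamp_norm (real (Suc n)) (u x)))\<^sup>2) \<le> (cmod (u x))\<^sup>2" for n
      by (auto intro!: power_mono clamp_norm_diff_le)
  qed (use iu in auto)
  then have "\<forall>\<^sub>F n in sequentially. (LINT x|lborel. (cmod (u x - clamp_norm (real (Suc n)) (u x)))\<^sup>2) < e / 4"
    using \<open>e > 0\<close> by (intro order_tendstoD(2)[where y = 0]) auto
  then obtain n where n: "(LINT x|lborel. (cmod (u x - clamp_norm (real (Suc n)) (u x)))\<^sup>2) < e / 4"
    by (auto simp: eventually_sequentially)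
  define M where "M = real (Suc n)"
  define u' where "u' = (\<lambda>x. clamp_norm M (u x))"
  have M: "M > 0" by (simp add: M_def)
  have u'm [measurable]: "u' \<in> borel_measurable borel" unfolding u'_def by measurable
  \<comment> \<open>This exhibits \<open>u\<close> as an almost everywhere limit of continuous
    functions \<open>g n\<close>. Clamping them too keeps them continuous and makes them uniformly
    bounded.\<close>
  have "u measurable_on UNIV"
    by (rule lebesgue_measurable_imp_measurable_on) (auto simp: measurable_completion)
  then obtain N g where N: "negligible N" and g: "\<And>n. continuous_on UNIV (g n)"
    and lim: "\<And>x. x \<notin> N \<Longrightarrow> (\<lambda>n. g n x) \<longlonglongrightarrow> u x"
    unfolding measurable_on_def by auto
  define w where "w k x = clamp_norm M (g k x)" for k x
  have wc: "continuous_on UNIV (w k)" for k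
    unfolding w_def
    by (rule continuous_on_compose2[OF continuous_at_imp_continuous_on[of UNIV] g])
      (auto intro: isCont_clamp_norm M)
  have [measurable]: "w k \<in> borel_measurable borel" for k
    using wc by (rule borel_measurable_continuous_onI)
  have wb: "cmod (w k x) \<le> M" for k x by (simp add: w_def clamp_norm_le M)
  have u'b: "cmod (u' x) \<le> M" for x by (simp add: u'_def clamp_norm_le M)
  have dif: "(cmod (u' x - w k x))\<^sup>2 \<le> (2 * M)\<^sup>2" for x k
    using norm_triangle_ineq4[of "u' x" "w k x"] wb[of k x] u'b[of x]
    by (intro power_mono) auto
  have "AE x in lebesgue. x \<notin> N"
    using N by (auto simp: negligible_iff_null_sets intro: AE_not_in)
  then have AE: "AE x in lborel. x \<notin> N"
    by (simp add: AE_completion_iff)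
  have "(\<lambda>k. LINT x|lborel. indicator B x * (cmod (u' x - w k x))\<^sup>2) \<longlonglongrightarrow> (LINT x|(lborel :: 'a measure). (0::real))"
  proof (rule integral_dominated_convergence[where w = "\<lambda>x. indicator B x * (2 * M)\<^sup>2"])
    show "AE x in lborel. (\<lambda>k. indicator B x * (cmod (u' x - w k x))\<^sup>2) \<longlonglongrightarrow> 0"
      using AE
    proof eventually_elim
      case (elim x)
      have "(\<lambda>k. w k x) \<longlonglongrightarrow> u' x"
        unfolding w_def u'_def by (rule isCont_tendsto_compose[OF isCont_clamp_norm[OF M] lim[OF elim]])
      then have "(\<lambda>k. indicator B x * (cmod (u' x - w k x))\<^sup>2) \<longlonglongrightarrow> indicator B x * (cmod (u' x - u' x))\<^sup>2"
        by (intro tendsto_intros)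
      then show ?case by simp
    qed
    show "AE x in lborel. norm (indicator B x * (cmod (u' x - w k x))\<^sup>2) \<le> indicator B x * (2 * M)\<^sup>2" for k
      using dif by (auto simp: indicator_def)
    show "integrable lborel (\<lambda>x. indicator B x * (2 * M)\<^sup>2)"
      using fB by (intro integrable_mult_left)
  qed auto
  then have "\<forall>\<^sub>F k in sequentially. (LINT x|lborel. indicator B x * (cmod (u' x - w k x))\<^sup>2) < e / 4"
    using \<open>e > 0\<close> by (intro order_tendstoD(2)[where y = 0]) auto
  then obtain k where k: "(LINT x|lborel. indicator B x * (cmod (u' x - w k x))\<^sup>2) < e / 4"
    by (auto simp: eventually_sequentially)
  have i1: "integrable lborel (\<lambda>x. (cmod (u x - u' x))\<^sup>2)"
    by (rule Bochner_Integration.integrable_bound[OF iu])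
      (auto simp: u'_def intro!: power_mono clamp_norm_diff_le M)
  have i2: "integrable lborel (\<lambda>x. indicator B x * (cmod (u' x - w k x))\<^sup>2)"
    by (rule Bochner_Integration.integrable_bound[OF integrable_mult_left[OF fB, of "(2 * M)\<^sup>2"]])
      (use dif in \<open>auto simp: indicator_def\<close>)
  \<comment> \<open>Squaring the triangle inequality costs a factor \<open>2\<close> on each error,
    hence the two tolerances \<open>e / 4\<close>.\<close>
  have le: "indicator B x * (cmod (u x - w k x))\<^sup>2
      \<le> 2 * (cmod (u x - u' x))\<^sup>2 + 2 * (indicator B x * (cmod (u' x - w k x))\<^sup>2)" for x
  proof -
    have "(cmod (u x - w k x))\<^sup>2 \<le> (cmod (u x - u' x) + cmod (u' x - w k x))\<^sup>2"
      using norm_triangle_ineq[of "u x - u' x" "u' x - w k x"] by (intro power_mono) auto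
    also have "\<dots> \<le> 2 * (cmod (u x - u' x))\<^sup>2 + 2 * (cmod (u' x - w k x))\<^sup>2"
      using sum_squares_bound[of "cmod (u x - u' x)" "cmod (u' x - w k x)"] by (simp add: power2_sum)
    finally show ?thesis by (auto simp: indicator_def)
  qed
  have "(LINT x|lborel. indicator B x * (cmod (u x - w k x))\<^sup>2)
     \<le> (LINT x|lborel. 2 * (cmod (u x - u' x))\<^sup>2 + 2 * (indicator B x * (cmod (u' x - w k x))\<^sup>2))"
    using i1 i2 le by (intro integral_mono_AE' ) auto
  also have "\<dots> < e"
    using n k i1 i2 \<open>e > 0\<close> by (simp add: u'_def M_def)
  finally show thesis using that wc wb by blast
qed

text \<open>A bounded continuous approximation \<open>w\<close> of \<open>u\<close> converges under
  translation by dominated convergence with majorant \<open>M * cmod (v x)\<close>; the remainder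
  \<open>d\<close> is controlled uniformly in the shift.\<close>

lemma tendsto_correlation:
  fixes u v :: "'a::euclidean_space \<Rightarrow> complex" and h :: "nat \<Rightarrow> 'a"
  assumes u: "square_integrable u" and v: "square_integrable v"
    and K: "bounded K" "\<And>x. x \<notin> K \<Longrightarrow> v x = 0"
    and v1: "integrable lborel v" and h: "h \<longlonglongrightarrow> 0"
  shows "(\<lambda>n. correlation u v (h n)) \<longlonglongrightarrow> correlation u v 0"
  unfolding tendsto_iff
proof safe
  fix e :: real assume "e > 0"
  obtain R where R: "\<And>x. x \<in> K \<Longrightarrow> norm x \<le> R" using K by (auto simp: bounded_iff)
  \<comment> \<open>The extra radius \<open>1\<close> keeps \<open>x - h\<close> in \<open>B\<close>
    for \<open>x\<close> in \<open>K\<close> and \<open>norm h \<le> 1\<close>.\<close>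
  define B where "B = cball (0::'a) (R + 1)"
  define V where "V = (LINT x|lborel. (cmod (v x))\<^sup>2)"
  \<comment> \<open>With this weight the \<open>v\<close> part of \<open>correlation_bound\<close>
    is at most \<open>e / 6\<close>; the approximation error \<open>e / (6 * s)\<close> makes the
    \<open>d\<close> part at most \<open>e / 6\<close> as well. Adding \<open>1\<close> to
    \<open>V\<close> ensures \<open>s > 0\<close>.\<close>
  define s where "s = 6 * (V + 1) / e"
  have V: "V \<ge> 0" by (simp add: V_def)
  have s: "s > 0" using \<open>e > 0\<close> V by (simp add: s_def)
  have Vs: "V / s \<le> e / 6" using \<open>e > 0\<close> V by (simp add: s_def field_simps)
  obtain w M where w: "continuous_on UNIV w" and wM: "\<And>x. cmod (w x) \<le> M"
    and wu: "(LINT x|lborel. indicator B x * (cmod (u x - w x))\<^sup>2) < e / (6 * s)"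
    by (rule continuous_approx_L2[OF u, of "e / (6 * s)" B]) (use s \<open>e > 0\<close> in \<open>auto simp: B_def\<close>)
  have [measurable]: "w \<in> borel_measurable borel" using w by (rule borel_measurable_continuous_onI)
  have [measurable]: "u \<in> borel_measurable borel" "v \<in> borel_measurable borel" "B \<in> sets borel"
    using u v by (auto simp: B_def)
  define d where "d x = indicator B x * (u x - w x)" for x
  have dsq: "(cmod (d x))\<^sup>2 = indicator B x * (cmod (u x - w x))\<^sup>2" for x
    by (simp add: d_def norm_mult power_mult_distrib indicator_def)
  have wi: "integrable lborel (\<lambda>x. w (x - h) * cnj (v x))" for h
    by (rule Bochner_Integration.integrable_bound[OF integrable_mult_right[OF integrable_norm[OF v1], of M]])
      (use wM in \<open>auto simp: norm_mult intro!: mult_right_mono order_trans[OF _ abs_ge_self]\<close>)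
  have d: "square_integrable d"
  proof -
    have fB: "integrable lborel (indicator B :: 'a \<Rightarrow> real)"
      using emeasure_lborel_cball_finite[of "0::'a" "R + 1"] by (simp add: B_def less_top[symmetric])
    have iu: "integrable lborel (\<lambda>x. (cmod (u x))\<^sup>2)" using u by (simp add: square_integrable_def)
    have "(cmod (d x))\<^sup>2 \<le> 2 * (cmod (u x))\<^sup>2 + indicator B x * (2 * M\<^sup>2)" for x
    proof -
      have "(cmod (u x - w x))\<^sup>2 \<le> (cmod (u x) + M)\<^sup>2"
        using norm_triangle_ineq4[of "u x" "w x"] wM[of x] by (intro power_mono) auto
      also have "\<dots> \<le> 2 * (cmod (u x))\<^sup>2 + 2 * M\<^sup>2"
        using sum_squares_bound[of "cmod (u x)" M] by (simp add: power2_sum)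
      finally show ?thesis by (auto simp: dsq indicator_def)
    qed
    then have "integrable lborel (\<lambda>x. (cmod (d x))\<^sup>2)"
      by (intro Bochner_Integration.integrable_bound[OF Bochner_Integration.integrable_add[OF
            integrable_mult_right[OF iu, of 2] integrable_mult_left[OF fB, of "2 * M\<^sup>2"]]])
        (auto simp: d_def intro!: order_trans[OF _ abs_ge_self])
    moreover have "d \<in> borel_measurable borel" unfolding d_def [abs_def] by measurable
    ultimately show ?thesis by (simp add: square_integrable_def)
  qed
  have split: "correlation u v h = correlation d v h + correlation w v h" if "norm h \<le> 1" for h
  proof -
    have "u (x - h) * cnj (v x) = d (x - h) * cnj (v x) + w (x - h) * cnj (v x)" for x
    proof (cases "x \<in> K")
      case True
      then have "x - h \<in> B"
        using R[of x] norm_triangle_ineq4[of x h] that by (simp add: B_def)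
      then show ?thesis by (simp add: d_def algebra_simps)
    qed (simp add: K)
    then show ?thesis
      using integrable_mult_cnj[OF square_integrable_shift[OF d] v] wi
      by (simp add: correlation_def)
  qed
  have db: "cmod (correlation d v h) < e / 3" for h
  proof -
    have "cmod (correlation d v h) \<le> s * (LINT x|lborel. (cmod (d x))\<^sup>2) + V / s"
      unfolding V_def by (rule correlation_bound[OF d v s])
    also have "s * (LINT x|lborel. (cmod (d x))\<^sup>2) < s * (e / (6 * s))"
      unfolding dsq using wu s by (intro mult_strict_left_mono)
    also have "s * (e / (6 * s)) = e / 6" using s by simp
    finally show ?thesis using Vs \<open>e > 0\<close> by linarith
  qed
  have "(\<lambda>n. LINT x|lborel. w (x - h n) * cnj (v x)) \<longlonglongrightarrow> (LINT x|lborel. w (x - 0) * cnj (v x))"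
  proof (rule integral_dominated_convergence[where w = "\<lambda>x. M * cmod (v x)"])
    show "AE x in lborel. (\<lambda>n. w (x - h n) * cnj (v x)) \<longlonglongrightarrow> w (x - 0) * cnj (v x)"
      using w h by (intro AE_I2 tendsto_mult tendsto_const continuous_on_tendsto_compose[where f = w and s = UNIV])
         (auto intro!: tendsto_eq_intros)
    show "AE x in lborel. norm (w (x - h n) * cnj (v x)) \<le> M * cmod (v x)" for n
      using wM by (auto simp: norm_mult intro!: mult_right_mono)
  qed (use v1 in auto)
  then have "(\<lambda>n. correlation w v (h n)) \<longlonglongrightarrow> correlation w v 0"
    by (simp add: correlation_def)
  then have "\<forall>\<^sub>F n in sequentially. dist (correlation w v (h n)) (correlation w v 0) < e / 3"
    using \<open>e > 0\<close> by (intro tendstoD) auto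
  moreover have "\<forall>\<^sub>F n in sequentially. dist (h n) 0 < 1"
    using h by (auto simp: tendsto_iff)
  ultimately show "\<forall>\<^sub>F n in sequentially. dist (correlation u v (h n)) (correlation u v 0) < e"
  proof eventually_elim
    case (elim n)
    have "correlation u v (h n) - correlation u v 0
      = (correlation w v (h n) - correlation w v 0) + (correlation d v (h n) - correlation d v 0)"
      using elim by (simp add: split)
    then have "cmod (correlation u v (h n) - correlation u v 0)
      \<le> cmod (correlation w v (h n) - correlation w v 0) + (cmod (correlation d v (h n)) + cmod (correlation d v 0))"
      by (metis norm_triangle_mono norm_triangle_ineq4 order_refl)
    then show ?case
      using elim db[of "h n"] db[of 0] by (simp add: dist_norm)
  qed
qed

section \<open>Double integrals against rescaled kernels\<close>

text \<open>After the substitution \<open>y = x - e z\<close>, a double integral against \<open>\<kappa> ((x - y) / e)\<close> only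
  involves \<open>u\<close> and \<open>v\<close> through their correlation.\<close>

lemma integral_convolution_correlation:
  fixes u v :: "'a::euclidean_space \<Rightarrow> complex" and \<kappa> :: "'a \<Rightarrow> real"
  assumes u: "integrable lborel u" and v: "integrable lborel v"
    and \<kappa>: "\<kappa> \<in> borel_measurable borel" "\<And>z. \<bar>\<kappa> z\<bar> \<le> C" and "e > 0"
  shows "integrable lborel (\<lambda>x. (LINT y|lborel. u y * of_real (\<kappa> ((x - y) /\<^sub>R e))) * cnj (v x))" (is ?i)
    "(LINT x|lborel. (LINT y|lborel. u y * of_real (\<kappa> ((x - y) /\<^sub>R e))) * cnj (v x))
      = e ^ DIM('a) *\<^sub>R (LINT z|lborel. of_real (\<kappa> z) * correlation u v (e *\<^sub>R z))" (is ?eq)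
proof -
  have [measurable]: "u \<in> borel_measurable borel" "v \<in> borel_measurable borel"
    "\<kappa> \<in> borel_measurable borel"
    using u v \<kappa> by auto
  define H where "H x z = u (x - e *\<^sub>R z) * of_real (\<kappa> z) * cnj (v x)" for x z
  have ui: "integrable lborel (\<lambda>z. u (x - e *\<^sub>R z))" for x
    using lborel_integrable_affine[of "- e" u x] u \<open>e > 0\<close> by simp
  have ui\<kappa>: "integrable lborel (\<lambda>z. u (x - e *\<^sub>R z) * of_real (\<kappa> z))" for x
    by (rule Bochner_Integration.integrable_bound[OF integrable_mult_left[OF integrable_norm[OF ui[of x]], of C]])
      (use \<kappa> in \<open>auto simp: norm_mult intro!: mult_left_mono order_trans[OF _ abs_ge_self]\<close>)
  have sub: "(LINT y|lborel. u y * of_real (\<kappa> ((x - y) /\<^sub>R e)))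
      = e ^ DIM('a) *\<^sub>R (LINT z|lborel. u (x - e *\<^sub>R z) * of_real (\<kappa> z))" for x
    by (subst lborel_integral_affine[of "- e" _ x]) (use \<open>e > 0\<close> in auto)
  \<comment> \<open>\<open>C\<close> bounds the kernel, and translation invariance removes
    \<open>x\<close> from the integral of \<open>cmod (u (x - e *\<^sub>R z))\<close>. The resulting
    majorant \<open>I * cmod (v x)\<close> is integrable, as Fubini requires.\<close>
  define I where "I = (LINT z|lborel. cmod (u (- (e *\<^sub>R z)))) * C"
  have nH: "(LINT z|lborel. norm (H x z)) \<le> I * cmod (v x)" for x
  proof -
    have "(LINT z|lborel. norm (H x z)) \<le> (LINT z|lborel. cmod (u (x - e *\<^sub>R z)) * C * cmod (v x))"
      unfolding H_def
      using \<kappa> integrable_norm[OF ui\<kappa>[of x]] integrable_norm[OF ui[of x]]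
      by (intro integral_mono) (auto simp: norm_mult intro!: mult_right_mono mult_left_mono)
    also have "\<dots> = (LINT z|lborel. cmod (u (x - e *\<^sub>R z))) * C * cmod (v x)"
      by simp
    also have "(LINT z|lborel. cmod (u (x - e *\<^sub>R z))) = (LINT z|lborel. cmod (u (- (e *\<^sub>R z))))"
      using lborel_integral_affine[of 1 "\<lambda>z. cmod (u (x - e *\<^sub>R z))" "x /\<^sub>R e"] \<open>e > 0\<close>
      by (simp add: algebra_simps)
    finally show ?thesis by (simp add: I_def)
  qed
  have int: "integrable (lborel \<Otimes>\<^sub>M lborel) (case_prod H)"
  proof (rule lborel_pair.Fubini_integrable)
    show "case_prod H \<in> borel_measurable (lborel \<Otimes>\<^sub>M lborel)"
      unfolding H_def by measurable
    show "integrable lborel (\<lambda>x. LINT z|lborel. norm (case (x, z) of (x, z) \<Rightarrow> H x z))"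
    proof (rule Bochner_Integration.integrable_bound[OF integrable_mult_right[OF integrable_norm[OF v], of I]])
      show "(\<lambda>x. LINT z|lborel. norm (case (x, z) of (x, z) \<Rightarrow> H x z)) \<in> borel_measurable lborel"
        unfolding H_def by measurable
      show "AE x in lborel. norm (LINT z|lborel. norm (case (x, z) of (x, z) \<Rightarrow> H x z)) \<le> norm (I * norm (v x))"
        using nH by (auto intro!: order_trans[OF _ abs_ge_self])
    qed
    show "AE x in lborel. integrable lborel (\<lambda>z. case (x, z) of (x, z) \<Rightarrow> H x z)"
      using ui\<kappa> by (auto simp: H_def)
  qed
  have iH: "(LINT z|lborel. H x z) = (LINT z|lborel. u (x - e *\<^sub>R z) * of_real (\<kappa> z)) * cnj (v x)" for x
    unfolding H_def by simp
  have "integrable lborel (\<lambda>x. LINT z|lborel. H x z)"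
    using lborel_pair.integrable_fst[OF int] by simp
  then show ?i
    unfolding sub iH by simp
  have "(LINT x|lborel. (LINT y|lborel. u y * of_real (\<kappa> ((x - y) /\<^sub>R e))) * cnj (v x))
      = e ^ DIM('a) *\<^sub>R (LINT x|lborel. (LINT z|lborel. H x z))"
    unfolding sub iH by simp
  also have "(LINT x|lborel. (LINT z|lborel. H x z)) = (LINT z|lborel. (LINT x|lborel. H x z))"
    by (rule lborel_pair.Fubini_integral[OF int, symmetric])
  also have "(\<lambda>z. LINT x|lborel. H x z) = (\<lambda>z. of_real (\<kappa> z) * correlation u v (e *\<^sub>R z))"
    unfolding H_def correlation_def by (simp flip: integral_mult_right_zero add: mult_ac)
  finally show ?eq .
qed

text \<open>Correlations are bounded and continuous at \<open>0\<close>, so dominated convergence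
  against \<open>\<kappa>\<close> leaves only the total mass of the kernel.\<close>

lemma tendsto_integral_correlation:
  fixes u v :: "'a::euclidean_space \<Rightarrow> complex" and e :: "nat \<Rightarrow> real"
  assumes u: "square_integrable u" and v: "square_integrable v"
    and K: "bounded K" "\<And>x. x \<notin> K \<Longrightarrow> v x = 0"
    and v1: "integrable lborel v" and e: "e \<longlonglongrightarrow> 0" and \<kappa>: "integrable lborel \<kappa>"
  shows "(\<lambda>n. LINT z|lborel. of_real (\<kappa> z) * correlation u v (e n *\<^sub>R z))
    \<longlonglongrightarrow> of_real (LINT z|lborel. \<kappa> z) * (LINT x|lborel. u x * cnj (v x))"
proof -
  define C where "C = (LINT x|lborel. (cmod (u x))\<^sup>2) + (LINT x|lborel. (cmod (v x))\<^sup>2)"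
  have C: "cmod (correlation u v h) \<le> C" for h
    using correlation_bound[OF u v, of 1 h] by (simp add: C_def)
  have [measurable]: "\<kappa> \<in> borel_measurable borel" "u \<in> borel_measurable borel" "v \<in> borel_measurable borel"
    using \<kappa> u v by auto
  have "(\<lambda>n. LINT z|lborel. of_real (\<kappa> z) * correlation u v (e n *\<^sub>R z))
    \<longlonglongrightarrow> (LINT z|lborel. of_real (\<kappa> z) * correlation u v 0)"
  proof (rule integral_dominated_convergence[where w = "\<lambda>z. \<bar>\<kappa> z\<bar> * C"])
    show "AE z in lborel. (\<lambda>n. of_real (\<kappa> z) * correlation u v (e n *\<^sub>R z))
        \<longlonglongrightarrow> of_real (\<kappa> z) * correlation u v 0"
    proof (intro AE_I2 tendsto_mult tendsto_const)
      fix z :: 'a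
      have "(\<lambda>n. e n *\<^sub>R z) \<longlonglongrightarrow> 0" using tendsto_scaleR[OF e tendsto_const[of z]] by simp
      then show "(\<lambda>n. correlation u v (e n *\<^sub>R z)) \<longlonglongrightarrow> correlation u v 0"
        using u v K v1 by (intro tendsto_correlation[where K = K])
    qed
    show "AE z in lborel. norm (of_real (\<kappa> z) * correlation u v (e n *\<^sub>R z)) \<le> \<bar>\<kappa> z\<bar> * C" for n
      using C by (auto simp: norm_mult intro!: mult_left_mono)
    show "integrable lborel (\<lambda>z. \<bar>\<kappa> z\<bar> * C)" using \<kappa> by auto
  qed auto
  then show ?thesis by (simp add: correlation_def)
qed

lemma correlation_minus:
  assumes [measurable]: "u \<in> borel_measurable borel" "v \<in> borel_measurable borel"
  shows "cnj (correlation u v (- h)) = correlation v u h"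
proof -
  have "cnj (correlation u v (- h)) = (LINT x|lborel. cnj (u (x - - h) * cnj (v x)))"
    unfolding correlation_def by (rule Bochner_Integration.integral_cnj[symmetric])
  also have "\<dots> = (LINT x|lborel. v x * cnj (u (x + h)))"
    by (intro Bochner_Integration.integral_cong refl) (simp add: mult.commute)
  also have "\<dots> = (LINT x|lborel. v (x - h) * cnj (u x))"
    by (subst lborel_integral_affine[of 1 _ "- h"]) auto
  finally show ?thesis by (simp add: correlation_def)
qed

lemma integrable_mult_correlation:
  assumes u: "square_integrable u" and v: "square_integrable v" and \<kappa>: "integrable lborel \<kappa>"
  shows "integrable lborel (\<lambda>z. of_real (\<kappa> z) * correlation u v (e *\<^sub>R z))"
proof -
  have [measurable]: "\<kappa> \<in> borel_measurable borel" "u \<in> borel_measurable borel" "v \<in> borel_measurable borel"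
    using \<kappa> u v by auto
  define C where "C = (LINT x|lborel. (cmod (u x))\<^sup>2) + (LINT x|lborel. (cmod (v x))\<^sup>2)"
  have C: "cmod (correlation u v h) \<le> C" for h
    using correlation_bound[OF u v, of 1 h] by (simp add: C_def)
  then have "0 \<le> C" using norm_ge_zero order_trans by blast
  with C have "cmod (of_real (\<kappa> z) * correlation u v (e *\<^sub>R z)) \<le> norm (norm (\<kappa> z) * C)" for z
    by (simp add: norm_mult abs_mult mult_left_mono)
  then show ?thesis
    by (intro Bochner_Integration.integrable_bound[OF integrable_mult_left[OF integrable_norm[OF \<kappa>], of C]])
      auto
qed

text \<open>Hermitian symmetry of the correlation together with the reflection of \<open>z\<close>:
  conjugation swaps the two functions and reflects the kernel. For an even kernel and
  \<open>u = v\<close> the integral is therefore real.\<close>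

lemma cnj_integral_correlation:
  fixes u v :: "'a::euclidean_space \<Rightarrow> complex"
  assumes [measurable]: "u \<in> borel_measurable borel" "v \<in> borel_measurable borel"
    "\<kappa> \<in> borel_measurable borel"
  shows "cnj (LINT z|lborel. of_real (\<kappa> z) * correlation u v (e *\<^sub>R z))
    = (LINT z|lborel. of_real (\<kappa> (- z)) * correlation v u (e *\<^sub>R z))"
proof -
  have "cnj (LINT z|lborel. of_real (\<kappa> z) * correlation u v (e *\<^sub>R z))
      = (LINT z|lborel. cnj (of_real (\<kappa> z) * correlation u v (e *\<^sub>R z)))"
    by (rule Bochner_Integration.integral_cnj[symmetric])
  also have "\<dots> = (LINT z|lborel. cnj (of_real (\<kappa> (- z)) * correlation u v (- (e *\<^sub>R z))))"
    by (subst lborel_integral_affine[of "- 1" _ 0]) auto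
  also have "\<dots> = (LINT z|lborel. of_real (\<kappa> (- z)) * correlation v u (e *\<^sub>R z))"
    by (simp only: complex_cnj_mult complex_cnj_complex_of_real correlation_minus[OF assms(1,2)])
  finally show ?thesis .
qed

section \<open>The energy identity\<close>

text \<open>On the support, which has finite measure, \<open>cmod (u x)\<close> is at most
  \<open>1 + (cmod (u x))\<^sup>2\<close>.\<close>

lemma integrable_square_integrable:
  assumes u: "square_integrable u" and K: "compact K" "\<And>x. x \<notin> K \<Longrightarrow> u x = 0"
  shows "integrable lborel u"
proof (rule Bochner_Integration.integrable_bound)
  show "integrable lborel (\<lambda>x. indicator K x + (cmod (u x))\<^sup>2)"
    using u emeasure_compact_finite[OF K(1)] borel_compact[OF K(1)]
    by (intro Bochner_Integration.integrable_add) (auto simp: square_integrable_def less_top)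
  show "u \<in> borel_measurable lborel" using u by (simp add: square_integrable_def)
  have "cmod (u x) \<le> 1 + (cmod (u x))\<^sup>2" for x
    using cmod_mult_le_squares[of 1 1 "u x"] by simp
  then show "AE x in lborel. norm (u x) \<le> norm (indicator K x + (cmod (u x))\<^sup>2)"
    using K(2) by (auto simp: indicator_def)
qed

lemma integrable_mult_continuous:
  assumes u: "integrable lborel u" and K: "compact K" "\<And>x. x \<notin> K \<Longrightarrow> u x = 0"
    and \<psi>: "continuous_on UNIV \<psi>"
  shows "integrable lborel (\<lambda>x. u x * (\<psi> x :: complex))"
proof -
  have [measurable]: "u \<in> borel_measurable borel" "\<psi> \<in> borel_measurable borel"
    using u borel_measurable_continuous_onI[OF \<psi>] by auto
  have "compact (\<psi> ` K)"
    using \<psi> K by (intro compact_continuous_image) (auto intro: continuous_on_subset)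
  then obtain C where "\<And>x. x \<in> K \<Longrightarrow> cmod (\<psi> x) \<le> C"
    by (fastforce dest!: compact_imp_bounded simp: bounded_iff)
  then have "cmod (u x * \<psi> x) \<le> norm (cmod (u x) * C)" for x
    using K(2)[of x]
    by (cases "x \<in> K") (auto simp: norm_mult abs_mult intro!: mult_left_mono order_trans[OF _ abs_ge_self])
  then show ?thesis
    by (intro Bochner_Integration.integrable_bound[OF integrable_mult_left[OF integrable_norm[OF u], of C]])
      auto
qed

text \<open>Splitting \<open>x $ i\<close> into \<open>(x - h) $ i + h $ i\<close> moves the
  coordinate weight to the other function. For \<open>h = e *\<^sub>R z\<close> the extra term
  carries the factor \<open>e\<close> that later cancels \<open>1 / e\<close>.\<close>

lemma correlation_coord:
  fixes u :: "real^'n::finite \<Rightarrow> complex"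
  assumes "square_integrable u" "square_integrable (\<lambda>x. of_real (x $ i) * u x)"
  shows "correlation u (\<lambda>x. of_real (x $ i) * u x) h
    = correlation (\<lambda>x. of_real (x $ i) * u x) u h + of_real (h $ i) * correlation u u h"
proof -
  have "correlation (\<lambda>x. of_real (x $ i) * u x) u h + of_real (h $ i) * correlation u u h
    = (LINT x|lborel. of_real ((x - h) $ i) * u (x - h) * cnj (u x) + of_real (h $ i) * (u (x - h) * cnj (u x)))"
    unfolding correlation_def
    using integrable_mult_cnj[OF square_integrable_shift[OF assms(2), of h] assms(1)]
      integrable_mult_cnj[OF square_integrable_shift[OF assms(1), of h] assms(1)]
    by (subst Bochner_Integration.integral_add) auto
  also have "\<dots> = correlation u (\<lambda>x. of_real (x $ i) * u x) h"
    unfolding correlation_def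
    by (intro Bochner_Integration.integral_cong refl) (simp add: algebra_simps)
  finally show ?thesis by simp
qed

text \<open>Here \<open>u\<close> plays the difference of two solutions and \<open>g\<close> the
  difference of their nonlinear terms, both extended by \<open>0\<close>; the source term has
  cancelled. How \<open>g\<close> depends on \<open>u\<close> enters only after the energy
  identity.\<close>

context
  fixes u g :: "real^'n::finite \<Rightarrow> complex" and K \<Omega> :: "(real^'n) set" and a c :: real and b :: complex
  assumes u: "square_integrable u" and g: "square_integrable g"
    and K: "compact K" and uK: "\<And>x. x \<notin> K \<Longrightarrow> u x = 0" and gK: "\<And>x. x \<notin> K \<Longrightarrow> g x = 0"
    and weak: "\<And>\<phi>. test_fun \<Omega> \<phi> \<Longrightarrow>
      Re (LINT x|lborel. u x * cnj (- laplacian_c \<phi> x))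
      + Re (LINT x|lborel. (- \<i> * of_real a * g x - \<i> * b * u x) * cnj (\<phi> x))
      + Re (\<i> * of_real c * (- (LINT x|lborel. u x * cnj (of_nat CARD('n) * \<phi> x + radial_deriv_c \<phi> x)))) = 0"
begin

abbreviation (input) coord_mult :: "'n \<Rightarrow> real^'n \<Rightarrow> complex" where
  "coord_mult i \<equiv> \<lambda>x. of_real (x $ i) * u x"

lemma square_integrable_coord: "square_integrable (coord_mult i)"
proof -
  have [measurable]: "u \<in> borel_measurable borel" using u by auto
  obtain R where R: "\<And>x. x \<in> K \<Longrightarrow> norm x \<le> R"
    using compact_imp_bounded[OF K] by (auto simp: bounded_iff)
  have le: "(cmod (of_real (x $ i) * u x))\<^sup>2 \<le> R\<^sup>2 * (cmod (u x))\<^sup>2" for x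
  proof (cases "x \<in> K")
    case True
    then have "\<bar>x $ i\<bar> \<le> R" using R[of x] component_le_norm_cart[of x i] by linarith
    then have "(cmod (of_real (x $ i) * u x))\<^sup>2 \<le> (R * cmod (u x))\<^sup>2"
      by (intro power_mono) (auto simp: norm_mult intro: mult_right_mono)
    then show ?thesis by (simp add: power_mult_distrib)
  qed (simp add: uK)
  have "integrable lborel (\<lambda>x. R\<^sup>2 * (cmod (u x))\<^sup>2)"
    using u by (simp add: square_integrable_def)
  then have "integrable lborel (\<lambda>x. (cmod (of_real (x $ i) * u x))\<^sup>2)"
    by (rule Bochner_Integration.integrable_bound) (use le in \<open>auto intro: order_trans[OF _ abs_ge_self]\<close>)
  then show ?thesis by (simp add: square_integrable_def)
qed

text \<open>Testing with a bump centred at \<open>x\<close> turns each integral into a mollified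
  value at \<open>x\<close>. The factors \<open>y $ i\<close> of the radial derivative are attached
  to \<open>u\<close>, which leaves kernels in \<open>x - y\<close> alone.\<close>

lemma weak_equation_mollified:
  fixes e :: real
  assumes "e > 0" and "cball x (e * CARD('n)) \<subseteq> \<Omega>"
  defines "S v k \<equiv> LINT y|lborel. v y * of_real (mbump k ((x - y) /\<^sub>R e))"
  shows "(\<Sum>i\<in>UNIV. S u ((\<lambda>_. 0)(i := 2))) / of_real (e\<^sup>2)
     + \<i> * of_real a * S g (\<lambda>_. 0) + \<i> * b * S u (\<lambda>_. 0)
     + \<i> * of_real c * (of_nat CARD('n) * S u (\<lambda>_. 0)
         - (\<Sum>i\<in>UNIV. S (coord_mult i) ((\<lambda>_. 0)(i := 1))) / of_real e) = 0"
    (is "?X = 0")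
proof -
  have int: "integrable lborel (\<lambda>y. v y * of_real (mbump k ((x - y) /\<^sub>R e)))"
    if "square_integrable v" "\<And>x. x \<notin> K \<Longrightarrow> v x = 0" for v k
    by (rule integrable_mult_continuous[OF integrable_square_integrable[OF that(1) K that(2)] K that(2)])
      (auto intro!: continuous_intros)
  note ints = int[OF u uK] int[OF g gK] int[OF square_integrable_coord]
  have "Re (cnj w * ?X) = 0" for w
  proof -
    let ?\<phi> = "scaled_mbump w e x (\<lambda>_. 0)"
    have 1: "(LINT y|lborel. u y * cnj (- laplacian_c ?\<phi> y))
       = - cnj w / of_real (e\<^sup>2) * (\<Sum>i\<in>UNIV. S u ((\<lambda>_. 0)(i := 2)))"
    proof -
      have "(LINT y|lborel. u y * cnj (- laplacian_c ?\<phi> y))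
         = (LINT y|lborel. - cnj w / of_real (e\<^sup>2) *
             (\<Sum>i\<in>UNIV. u y * of_real (mbump ((\<lambda>_. 0)(i := 2)) ((x - y) /\<^sub>R e))))"
        unfolding laplacian_scaled_mbump
        by (intro Bochner_Integration.integral_cong refl) (simp add: sum_distrib_left mult_ac sum_negf)
      also have "\<dots> = - cnj w / of_real (e\<^sup>2) * (\<Sum>i\<in>UNIV. S u ((\<lambda>_. 0)(i := 2)))"
        unfolding S_def integral_mult_right_zero using ints
        by (subst Bochner_Integration.integral_sum) auto
      finally show ?thesis .
    qed
    have 2: "(LINT y|lborel. (- \<i> * of_real a * g y - \<i> * b * u y) * cnj (?\<phi> y))
       = cnj w * (- \<i> * of_real a * S g (\<lambda>_. 0) - \<i> * b * S u (\<lambda>_. 0))"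
    proof -
      have "(LINT y|lborel. (- \<i> * of_real a * g y - \<i> * b * u y) * cnj (?\<phi> y))
         = (LINT y|lborel. (- cnj w * \<i> * of_real a) * (g y * of_real (mbump (\<lambda>_. 0) ((x - y) /\<^sub>R e)))
              - (cnj w * \<i> * b) * (u y * of_real (mbump (\<lambda>_. 0) ((x - y) /\<^sub>R e))))"
        unfolding scaled_mbump_def
        by (intro Bochner_Integration.integral_cong refl) (simp add: algebra_simps)
      also have "\<dots> = (- cnj w * \<i> * of_real a) * S g (\<lambda>_. 0) - (cnj w * \<i> * b) * S u (\<lambda>_. 0)"
        unfolding S_def using ints(1,2)[of "\<lambda>_. 0"] 
        by (subst Bochner_Integration.integral_diff) (auto simp del: mult_minus_left)
      finally show ?thesis by (simp add: algebra_simps)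
    qed
    have 3: "(LINT y|lborel. u y * cnj (of_nat CARD('n) * ?\<phi> y + radial_deriv_c ?\<phi> y))
       = cnj w * (of_nat CARD('n) * S u (\<lambda>_. 0)
         - (\<Sum>i\<in>UNIV. S (coord_mult i) ((\<lambda>_. 0)(i := 1))) / of_real e)"
    proof -
      have "(LINT y|lborel. u y * cnj (of_nat CARD('n) * ?\<phi> y + radial_deriv_c ?\<phi> y))
         = (LINT y|lborel. (cnj w * of_nat CARD('n)) * (u y * of_real (mbump (\<lambda>_. 0) ((x - y) /\<^sub>R e)))
            - cnj w / of_real e * (\<Sum>i\<in>UNIV. coord_mult i y * of_real (mbump ((\<lambda>_. 0)(i := 1)) ((x - y) /\<^sub>R e))))"
        unfolding radial_deriv_scaled_mbump scaled_mbump_def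
        by (intro Bochner_Integration.integral_cong refl)
          (simp add: algebra_simps sum_distrib_left sum_divide_distrib sum_negf)
      also have "\<dots> = (cnj w * of_nat CARD('n)) * S u (\<lambda>_. 0)
         - cnj w / of_real e * (\<Sum>i\<in>UNIV. S (coord_mult i) ((\<lambda>_. 0)(i := 1)))"
        unfolding S_def using ints
        by (subst Bochner_Integration.integral_diff) (auto simp: uK intro!: integrable_sum)
      finally show ?thesis by (simp add: algebra_simps)
    qed
    have "cnj w * ?X = - ((LINT y|lborel. u y * cnj (- laplacian_c ?\<phi> y))
        + (LINT y|lborel. (- \<i> * of_real a * g y - \<i> * b * u y) * cnj (?\<phi> y))
        + \<i> * of_real c * (- (LINT y|lborel. u y * cnj (of_nat CARD('n) * ?\<phi> y + radial_deriv_c ?\<phi> y))))"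
      unfolding 1 2 3 by (simp add: algebra_simps)
    then show ?thesis
      by (simp only: uminus_complex.sel plus_complex.sel weak[OF test_fun_scaled_mbump[OF assms(1,2)]]
          minus_zero)
  qed
  \<comment> \<open>The weights \<open>1\<close> and \<open>\<i>\<close> give the real and the
    imaginary part of the equation.\<close>
  from this[of 1] this[of \<i>] show ?thesis by (simp add: complex_eq_iff)
qed

text \<open>The mollified equation at \<open>x\<close> is multiplied by \<open>cnj (u x)\<close> and
  integrated. It is available for \<open>x\<close> in \<open>K\<close>, and elsewhere the factor
  \<open>cnj (u x)\<close> vanishes. The common Jacobian \<open>e ^ CARD('n)\<close> is divided
  out.\<close>

lemma weak_equation_averaged:
  fixes e :: real
  assumes e: "e > 0" and ball: "\<And>x. x \<in> K \<Longrightarrow> cball x (e * CARD('n)) \<subseteq> \<Omega>"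
  defines "M v k \<equiv> LINT z|lborel. of_real (mbump k z) * correlation v u (e *\<^sub>R z)"
  shows "(\<Sum>i\<in>UNIV. M u ((\<lambda>_. 0)(i := 2))) / of_real (e\<^sup>2)
     + \<i> * of_real a * M g (\<lambda>_. 0) + \<i> * b * M u (\<lambda>_. 0)
     + \<i> * of_real c * (of_nat CARD('n) * M u (\<lambda>_. 0)
         - (\<Sum>i\<in>UNIV. M (coord_mult i) ((\<lambda>_. 0)(i := 1))) / of_real e) = 0" (is "?X = 0")
proof -
  define J where "J v k x = (LINT y|lborel. v y * of_real (mbump k ((x - y) /\<^sub>R e))) * cnj (u x)"
    for v k and x :: "real^'n"
  have J: "integrable lborel (J v k)" "(LINT x|lborel. J v k x) = of_real (e ^ CARD('n)) * M v k"
    if "square_integrable v" "\<And>x. x \<notin> K \<Longrightarrow> v x = 0" for v k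
  proof -
    obtain B where B: "\<And>z. \<bar>mbump k z\<bar> \<le> B" using mbump_bounded by blast
    have m: "mbump k \<in> borel_measurable borel"
      by (intro borel_measurable_continuous_onI continuous_intros)
    note * = integral_convolution_correlation[OF integrable_square_integrable[OF that(1) K that(2)]
        integrable_square_integrable[OF u K uK] m B e]
    show "integrable lborel (J v k)" "(LINT x|lborel. J v k x) = of_real (e ^ CARD('n)) * M v k"
      using * by (simp_all add: J_def [abs_def] M_def scaleR_conv_of_real)
  qed
  note Ju = J[OF u uK] and Jg = J[OF g gK]
  have Ji: "integrable lborel (J (coord_mult i) k)"
     "(LINT x|lborel. J (coord_mult i) k x) = of_real (e ^ CARD('n)) * M (coord_mult i) k" for i k
    using J[OF square_integrable_coord] by (auto simp: uK)
  define P where "P x = (\<Sum>i\<in>UNIV. J u ((\<lambda>_. 0)(i := 2)) x) / of_real (e\<^sup>2)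
     + \<i> * of_real a * J g (\<lambda>_. 0) x + \<i> * b * J u (\<lambda>_. 0) x
     + \<i> * of_real c * (of_nat CARD('n) * J u (\<lambda>_. 0) x
         - (\<Sum>i\<in>UNIV. J (coord_mult i) ((\<lambda>_. 0)(i := 1)) x) / of_real e)" for x
  have "P x = 0" for x
  proof (cases "x \<in> K")
    case True
    show ?thesis
      using arg_cong[OF weak_equation_mollified[OF e ball[OF True]], of "\<lambda>z. z * cnj (u x)"]
      unfolding P_def J_def by (simp add: algebra_simps sum_distrib_left sum_distrib_right sum_divide_distrib)
  qed (simp add: P_def J_def uK)
  then have "0 = (LINT x|lborel. P x)" by simp
  also have "\<dots> = of_real (e ^ CARD('n)) * ?X"
    unfolding P_def using Ju Jg Ji
    by (simp add: algebra_simps sum_distrib_left sum_divide_distrib)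
  finally show ?thesis using e by simp
qed

text \<open>The Laplacian contributes a real double integral because its kernel is even, and the kernel
  \<open>y \<bullet> \<nabla>\<rho> (x - y)\<close> of the dilation term becomes a function of \<open>x - y\<close> after exchanging \<open>x\<close>
  and \<open>y\<close>.\<close>

lemma weak_equation_symmetrized:
  fixes e :: real
  assumes e: "e > 0" and ball: "\<And>x. x \<in> K \<Longrightarrow> cball x (e * CARD('n)) \<subseteq> \<Omega>"
  shows "a * Re (LINT z|lborel. of_real (mbump (\<lambda>_. 0) z) * correlation g u (e *\<^sub>R z))
    + (Re b + c * CARD('n)) * Re (LINT z|lborel. of_real (mbump (\<lambda>_. 0) z) * correlation u u (e *\<^sub>R z))
    + c / 2 * (\<Sum>i\<in>UNIV. Re (LINT z|lborel. of_real (z $ i * mbump ((\<lambda>_. 0)(i := 1)) z)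
        * correlation u u (e *\<^sub>R z))) = 0"
proof -
  have [measurable]: "u \<in> borel_measurable borel" using u by auto
  define M where "M v k = (LINT z|lborel. of_real (mbump k z) * correlation v u (e *\<^sub>R z))" for v k
  define D where "D i = (LINT z|lborel. of_real (z $ i * mbump ((\<lambda>_. 0)(i := 1)) z)
        * correlation u u (e *\<^sub>R z))" for i
  have mm [measurable]: "mbump k \<in> borel_measurable borel" for k :: "'n \<Rightarrow> nat"
    by (intro borel_measurable_continuous_onI continuous_intros)
  have mi: "integrable lborel (mbump k)" for k :: "'n \<Rightarrow> nat"
    using integrable_mbump[of "\<lambda>_. 1" k] by simp
  have even_real: "Im (M u k) = 0" if "even (\<Sum>i\<in>UNIV. k i)" for k
  proof -
    have "cnj (M u k) = M u k"
      unfolding M_def using that by (subst cnj_integral_correlation) (simp_all add: mbump_minus)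
    then show ?thesis by (simp add: complex_eq_iff)
  qed
  have i0: "Im (M u (\<lambda>_. 0)) = 0" by (rule even_real) simp
  have i2: "Im (M u ((\<lambda>_. 0)(i := 2))) = 0" for i
    by (rule even_real) (simp add: sum.remove[of UNIV i])
  \<comment> \<open>The kernel is odd, so with \<open>M\<close> and \<open>D\<close> for the two
    integrals conjugation gives \<open>cnj M = - M - e * D\<close>. Real parts yield
    \<open>2 * Re M = - e * Re D\<close>, which trades the coordinate weight on \<open>u\<close> for
    a moment of the kernel.\<close>
  have half: "Re (M (coord_mult i) ((\<lambda>_. 0)(i := 1))) = - e / 2 * Re (D i)" for i
  proof -
    define k :: "'n \<Rightarrow> nat" where "k = ((\<lambda>_. 0)(i := 1))"
    have odd: "mbump k (- z) = - mbump k z" for z :: "real^'n"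
      unfolding mbump_minus k_def by (simp add: sum.remove[of UNIV i])
    have ii: "integrable lborel (\<lambda>z::real^'n. z $ i * mbump k z)"
      by (intro integrable_mbump continuous_intros)
    have "cnj (M (coord_mult i) k)
       = (LINT z|lborel. of_real (- mbump k z) * correlation u (coord_mult i) (e *\<^sub>R z))"
      unfolding M_def by (subst cnj_integral_correlation) (simp_all add: odd)
    also have "\<dots> = (LINT z|lborel. - (of_real (mbump k z) * correlation (coord_mult i) u (e *\<^sub>R z))
         - of_real e * (of_real (z $ i * mbump k z) * correlation u u (e *\<^sub>R z)))"
      unfolding correlation_coord[OF u square_integrable_coord]
      by (intro Bochner_Integration.integral_cong refl) (simp add: algebra_simps)
    also have "\<dots> = - M (coord_mult i) k - of_real e * D i"
      unfolding M_def D_def k_def[symmetric]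
      using integrable_mult_correlation[OF square_integrable_coord[of i] u mi[of k], of e]
        integrable_mult_correlation[OF u u ii, of e]
      by (subst Bochner_Integration.integral_diff) (auto simp del: of_real_mult)
    finally have "Re (cnj (M (coord_mult i) k)) = Re (- M (coord_mult i) k - of_real e * D i)" by simp
    then show ?thesis by (simp add: k_def)
  qed
  \<comment> \<open>The imaginary part removes the real term with \<open>1 / e^2\<close> before any
    limit is taken.\<close>
  have "Im ((\<Sum>i\<in>UNIV. M u ((\<lambda>_. 0)(i := 2))) / of_real (e\<^sup>2)
     + \<i> * of_real a * M g (\<lambda>_. 0) + \<i> * b * M u (\<lambda>_. 0)
     + \<i> * of_real c * (of_nat CARD('n) * M u (\<lambda>_. 0)
         - (\<Sum>i\<in>UNIV. M (coord_mult i) ((\<lambda>_. 0)(i := 1))) / of_real e)) = 0"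
    using arg_cong[OF weak_equation_averaged[OF e ball], of Im] unfolding M_def by simp
  then have "a * Re (M g (\<lambda>_. 0)) + Re b * Re (M u (\<lambda>_. 0))
     + c * (CARD('n) * Re (M u (\<lambda>_. 0)) - (\<Sum>i\<in>UNIV. Re (M (coord_mult i) ((\<lambda>_. 0)(i := 1)))) / e) = 0"
    by (simp add: i0 i2 Im_divide_of_real Re_divide_of_real algebra_simps del: of_real_power)
  also have "(\<Sum>i\<in>UNIV. Re (M (coord_mult i) ((\<lambda>_. 0)(i := 1)))) / e = - (\<Sum>i\<in>UNIV. Re (D i)) / 2"
    unfolding half using e by (simp add: sum_divide_distrib sum_negf)
  finally show ?thesis unfolding M_def D_def by (simp add: algebra_simps)
qed

lemma energy_identity:
  assumes "open \<Omega>" "K \<subseteq> \<Omega>"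
  shows "a * Re (LINT x|lborel. g x * cnj (u x))
    + (Re b + c * CARD('n) / 2) * (LINT x|lborel. (cmod (u x))\<^sup>2) = 0"
proof -
  obtain d where "d > 0" and d: "(\<Union>x\<in>K. cball x d) \<subseteq> \<Omega>"
    using compact_subset_open_imp_cball_epsilon_subset[OF K assms] by blast
  \<comment> \<open>Dividing by \<open>CARD('n)\<close> compensates the radius
    \<open>e * CARD('n)\<close> of the supports, so every bump centred in \<open>K\<close> stays
    within distance \<open>d\<close>.\<close>
  define e where "e n = d / CARD('n) / real (Suc n)" for n
  have e0: "e \<longlonglongrightarrow> 0"
    unfolding e_def divide_inverse
    by (intro tendsto_mult_right_zero LIMSEQ_inverse_real_of_nat)
  have epos: "e n > 0" for n using \<open>d > 0\<close> by (simp add: e_def)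
  have ball: "cball x (e n * CARD('n)) \<subseteq> \<Omega>" if "x \<in> K" for x n
  proof -
    have "e n * CARD('n) = d / real (Suc n)" by (simp add: e_def)
    also have "\<dots> \<le> d" using \<open>d > 0\<close> by (simp add: field_simps)
    finally have "cball x (e n * CARD('n)) \<subseteq> cball x d" by (rule subset_cball)
    then show ?thesis using d that by blast
  qed
  define I where "I = (LINT z|lborel. mbump (\<lambda>_::'n. 0) z)"
  define Q where "Q = (LINT x|lborel. (cmod (u x))\<^sup>2)"
  define G where "G = (LINT x|lborel. g x * cnj (u x))"
  have u1: "integrable lborel u" by (rule integrable_square_integrable[OF u K uK])
  have Q: "(LINT x|lborel. u x * cnj (u x)) = of_real Q"
    unfolding Q_def by (subst integral_complex_of_real[symmetric]) (simp only: complex_norm_square)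
  have lim: "(\<lambda>n. Re (LINT z|lborel. of_real (\<kappa> z) * correlation v u (e n *\<^sub>R z)))
      \<longlonglongrightarrow> Re (of_real (LINT z|lborel. \<kappa> z) * (LINT x|lborel. v x * cnj (u x)))"
    if "square_integrable v" "integrable lborel \<kappa>" for v \<kappa>
    using tendsto_integral_correlation[OF that(1) u compact_imp_bounded[OF K] uK u1 e0 that(2)]
    by (intro tendsto_Re) auto
  have m0: "integrable lborel (mbump (\<lambda>_::'n. 0))"
    using integrable_mbump[of "\<lambda>_. 1"] by simp
  have m1: "integrable lborel (\<lambda>z::real^'n. z $ i * mbump ((\<lambda>_. 0)(i := 1)) z)" for i
    by (intro integrable_mbump continuous_intros)
  have "(\<lambda>n. a * Re (LINT z|lborel. of_real (mbump (\<lambda>_. 0) z) * correlation g u (e n *\<^sub>R z))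
    + (Re b + c * CARD('n)) * Re (LINT z|lborel. of_real (mbump (\<lambda>_. 0) z) * correlation u u (e n *\<^sub>R z))
    + c / 2 * (\<Sum>i\<in>UNIV. Re (LINT z|lborel. of_real (z $ i * mbump ((\<lambda>_. 0)(i := 1)) z)
        * correlation u u (e n *\<^sub>R z))))
    \<longlonglongrightarrow> a * Re (of_real I * G) + (Re b + c * CARD('n)) * Re (of_real I * of_real Q)
      + c / 2 * (\<Sum>i\<in>(UNIV::'n set). Re (of_real (- I) * of_real Q))"
    using lim[OF g m0] lim[OF u m0] lim[OF u m1] unfolding integral_mbump_1 I_def G_def Q
    by (intro tendsto_add tendsto_mult tendsto_const tendsto_sum)
  then have "(\<lambda>n::nat. 0::real) \<longlonglongrightarrow> a * Re (of_real I * G) + (Re b + c * CARD('n)) * Re (of_real I * of_real Q)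
      + c / 2 * (\<Sum>i\<in>(UNIV::'n set). Re (of_real (- I) * of_real Q))"
    by (simp only: weak_equation_symmetrized[OF epos ball])
  then have "a * Re (of_real I * G) + (Re b + c * CARD('n)) * Re (of_real I * of_real Q)
      + c / 2 * (\<Sum>i\<in>(UNIV::'n set). Re (of_real (- I) * of_real Q)) = 0"
    by (simp add: LIMSEQ_const_iff)
  \<comment> \<open>All limits share the mass \<open>I\<close> of the bump; the
    \<open>CARD('n)\<close> moments, each equal to \<open>- I\<close>, reduce
    \<open>c * CARD('n)\<close> to half of it.\<close>
  then have "I * (a * Re G + (Re b + c * CARD('n) / 2) * Q) = 0"
    by (simp add: algebra_simps)
  moreover have "I > 0" unfolding I_def by (rule integral_mbump_0_pos)
  ultimately show ?thesis unfolding G_def Q_def by simp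
qed

end

section \<open>Uniqueness\<close>

lemma borel_measurable_nonlin [measurable]: "nonlin m \<in> borel_measurable borel"
  unfolding nonlin_def [abs_def] by measurable

lemma cmod_nonlin: "cmod (nonlin m z) = (if z = 0 then 0 else cmod z powr m)"
  using powr_add[of "cmod z" "-(1 - m)" 1] by (simp add: nonlin_def norm_mult)

text \<open>The growth \<open>r^m\<close> with \<open>m < 1\<close> is sublinear for
  \<open>r \<ge> 1\<close> and bounded by \<open>1\<close> below, so the nonlinear term of a
  compactly supported L2 function is again in L2.\<close>

lemma cmod_nonlin_le:
  assumes "0 < m" "m < 1"
  shows "(cmod (nonlin m z))\<^sup>2 \<le> 1 + (cmod z)\<^sup>2"
proof (cases "cmod z \<le> 1")
  case True
  then have "cmod z powr m \<le> 1" using assms by (simp add: powr_le1)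
  then have "cmod (nonlin m z) \<le> 1" by (simp add: cmod_nonlin)
  then have "(cmod (nonlin m z))\<^sup>2 \<le> 1" by (simp add: power_le_one)
  then show ?thesis using zero_le_power2[of "cmod z"] by linarith
next
  case False
  then have "cmod z powr m \<le> cmod z powr 1" using assms by (intro powr_mono) auto
  then have "cmod (nonlin m z) \<le> cmod z" by (simp add: cmod_nonlin)
  then have "(cmod (nonlin m z))\<^sup>2 \<le> (cmod z)\<^sup>2" by (intro power_mono) auto
  then show ?thesis by linarith
qed

lemma nonlin_self: "nonlin m z * cnj z = of_real (cmod (nonlin m z) * cmod z)"
proof (cases "z = 0")
  case False
  have "nonlin m z * cnj z = of_real (cmod z powr (-(1 - m))) * (z * cnj z)"
    using False by (simp add: nonlin_def)
  also have "z * cnj z = of_real ((cmod z)\<^sup>2)" by (simp only: complex_norm_square)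
  finally show ?thesis
    using False by (simp add: nonlin_def norm_mult power2_eq_square)
qed (simp add: nonlin_def)

text \<open>With \<open>r = |z|\<close> and \<open>s = |w|\<close> the pairing is at least \<open>(r\<^sup>m - s\<^sup>m) (r - s)\<close>, which settles
  \<open>r \<noteq> s\<close>; for \<open>r = s\<close> the map is a positive multiple of the identity on \<open>{z, w}\<close>.\<close>

lemma nonlin_strict_mono:
  assumes "0 < m" "z \<noteq> w"
  shows "Re ((nonlin m z - nonlin m w) * cnj (z - w)) > 0"
proof (cases "cmod z = cmod w")
  case True
  then have "z \<noteq> 0" "w \<noteq> 0" using \<open>z \<noteq> w\<close> by auto
  then have "(nonlin m z - nonlin m w) * cnj (z - w) = of_real (cmod z powr (-(1 - m))) * ((z - w) * cnj (z - w))"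
    using True by (simp add: nonlin_def algebra_simps)
  also have "\<dots> = of_real (cmod z powr (-(1 - m)) * (cmod (z - w))\<^sup>2)"
    by (simp only: complex_norm_square[symmetric] of_real_mult)
  finally show ?thesis
    using \<open>z \<noteq> w\<close> \<open>z \<noteq> 0\<close> by simp
next
  case False
  define P where "P z = cmod (nonlin m z)" for z
  have P: "P z < P w" if "cmod z < cmod w" for z w
    using that \<open>0 < m\<close> by (auto simp: P_def cmod_nonlin powr_less_mono2)
  have "0 < (P z - P w) * (cmod z - cmod w)"
    using False P[of z w] P[of w z] by (cases "cmod z < cmod w") (auto intro: mult_neg_neg mult_pos_pos)
  also have "\<dots> = P z * cmod z + P w * cmod w - P z * cmod w - P w * cmod z"
    by (simp add: algebra_simps)
  also have "\<dots> \<le> Re (nonlin m z * cnj z) + Re (nonlin m w * cnj w)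
      - Re (nonlin m z * cnj w) - Re (nonlin m w * cnj z)"
    using complex_Re_le_cmod[of "nonlin m z * cnj w"] complex_Re_le_cmod[of "nonlin m w * cnj z"]
    unfolding nonlin_self Re_complex_of_real by (simp add: P_def norm_mult del: times_complex.sel)
  also have "\<dots> = Re ((nonlin m z - nonlin m w) * cnj (z - w))"
    by (simp add: algebra_simps)
  finally show ?thesis .
qed

lemma square_integrable_nonlin:
  assumes "0 < m" "m < 1" and u: "square_integrable u" and K: "compact K" "\<And>x. x \<notin> K \<Longrightarrow> u x = 0"
  shows "square_integrable (\<lambda>x. nonlin m (u x))"
proof -
  have [measurable]: "u \<in> borel_measurable borel" using u by auto
  have le: "(cmod (nonlin m (u x)))\<^sup>2 \<le> indicator K x + (cmod (u x))\<^sup>2" for x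
    using cmod_nonlin_le[OF assms(1,2), of "u x"] K(2)[of x] by (auto simp: indicator_def nonlin_def)
  have "integrable lborel (\<lambda>x. indicator K x + (cmod (u x))\<^sup>2)"
    using u emeasure_compact_finite[OF K(1)] borel_compact[OF K(1)]
    by (intro Bochner_Integration.integrable_add) (auto simp: square_integrable_def less_top)
  then have "integrable lborel (\<lambda>x. (cmod (nonlin m (u x)))\<^sup>2)"
    by (rule Bochner_Integration.integrable_bound) (use le in \<open>auto intro: order_trans[OF _ abs_ge_self]\<close>)
  then show ?thesis by (simp add: square_integrable_def)
qed

lemma square_integrable_diff:
  assumes "square_integrable u" "square_integrable v"
  shows "square_integrable (\<lambda>x. u x - v x)"
proof -
  have [measurable]: "u \<in> borel_measurable borel" "v \<in> borel_measurable borel" using assms by auto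
  have le: "(cmod (u x - v x))\<^sup>2 \<le> 2 * (cmod (u x))\<^sup>2 + 2 * (cmod (v x))\<^sup>2" for x
  proof -
    have "(cmod (u x - v x))\<^sup>2 \<le> (cmod (u x) + cmod (v x))\<^sup>2"
      by (intro power_mono norm_triangle_ineq4) auto
    also have "\<dots> \<le> 2 * (cmod (u x))\<^sup>2 + 2 * (cmod (v x))\<^sup>2"
      using sum_squares_bound[of "cmod (u x)" "cmod (v x)"] by (simp add: power2_sum)
    finally show ?thesis .
  qed
  have "integrable lborel (\<lambda>x. 2 * (cmod (u x))\<^sup>2 + 2 * (cmod (v x))\<^sup>2)"
    using assms by (simp add: square_integrable_def)
  then have "integrable lborel (\<lambda>x. (cmod (u x - v x))\<^sup>2)"
    by (rule Bochner_Integration.integrable_bound) (use le in \<open>auto intro: order_trans[OF _ abs_ge_self]\<close>)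
  then show ?thesis by (simp add: square_integrable_def)
qed

section \<open>From classes of functions on \<Omega> to Borel functions on the whole space\<close>

lemma smooth_c_continuous: "smooth_c f \<Longrightarrow> continuous_on A f"
  by (auto elim!: smooth_c.cases intro: continuous_at_imp_continuous_on differentiable_imp_continuous_within)

lemma smooth_c_pderiv: "smooth_c f \<Longrightarrow> smooth_c (pderiv_c i f)"
  by (auto elim: smooth_c.cases)

lemma AE_lebesgue_on_lborel:
  fixes S :: "'a::euclidean_space set"
  assumes "S \<in> sets lebesgue" "AE x in lborel. P x"
  shows "AE x in lebesgue_on S. P x"
  using assms AE_completion[OF assms(2)] by (auto simp: AE_restrict_space_iff elim: eventually_mono)

text \<open>The correlation arguments need functions that are Borel on the whole space and vanish at
  every point off a compact set, whereas membership in \<open>L2c_on\<close> provides this only up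
  to null sets of \<Omega>.\<close>

lemma L2c_on_borel_representative:
  assumes "open \<Omega>" "L2c_on \<Omega> U"
  obtains K V where "compact K" "K \<subseteq> \<Omega>" "square_integrable V" "\<And>x. x \<notin> K \<Longrightarrow> V x = 0"
    "AE x in lebesgue_on \<Omega>. U x = V x"
proof -
  obtain K where K: "compact K" "K \<subseteq> \<Omega>" and AEK: "AE x in lebesgue_on \<Omega>. x \<notin> K \<longrightarrow> U x = 0"
    and U: "U \<in> borel_measurable (lebesgue_on \<Omega>)" "integrable (lebesgue_on \<Omega>) (\<lambda>x. (cmod (U x))\<^sup>2)"
    using assms(2) by (auto simp: L2c_on_def L2_on_def)
  have \<Omega>: "\<Omega> \<in> sets lebesgue" using assms(1) by simp
  define W where "W x = (if x \<in> \<Omega> then U x else 0)" for x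
  have W: "W \<in> borel_measurable lebesgue"
    using U(1) \<Omega> borel_measurable_if by (auto simp: W_def [abs_def] borel_measurable_if)
  have "\<exists>f\<in>borel_measurable lborel. AE x in lborel. Re (W x) = f x"
    "\<exists>f\<in>borel_measurable lborel. AE x in lborel. Im (W x) = f x"
    using W by (intro completion_ex_borel_measurable_real; simp)+
  then obtain f1 f2 where f [measurable]: "f1 \<in> borel_measurable lborel" "f2 \<in> borel_measurable lborel"
    and AEf: "AE x in lborel. Re (W x) = f1 x" "AE x in lborel. Im (W x) = f2 x" by blast
  \<comment> \<open>Cutting off at \<open>K\<close> affects \<Omega> only on a null set, since
    \<open>U\<close> vanishes almost everywhere in \<Omega> outside \<open>K\<close>.\<close>
  define V where "V x = (if x \<in> K then Complex (f1 x) (f2 x) else 0)" for x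
  have [measurable]: "K \<in> sets borel" using K(1) by (simp add: borel_compact)
  have V [measurable]: "V \<in> borel_measurable borel"
    unfolding V_def [abs_def] Complex_eq by measurable
  have "AE x in lebesgue_on \<Omega>. Re (W x) = f1 x \<and> Im (W x) = f2 x"
    using AEf by (intro AE_lebesgue_on_lborel \<Omega>) auto
  moreover have "AE x in lebesgue_on \<Omega>. x \<in> \<Omega>"
    using \<Omega> by (intro AE_I2) (simp add: space_restrict_space)
  ultimately have AE: "AE x in lebesgue_on \<Omega>. U x = V x"
    using AEK by eventually_elim (auto simp: V_def W_def complex_eq_iff)
  have "integrable (lebesgue_on \<Omega>) (\<lambda>x. (cmod (V x))\<^sup>2)"
  proof (rule integrable_cong_AE_imp[OF U(2)])
    show "(\<lambda>x. (cmod (V x))\<^sup>2) \<in> borel_measurable (lebesgue_on \<Omega>)"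
      by (intro measurable_restrict_space1 measurable_completion) measurable
    show "AE x in lebesgue_on \<Omega>. (cmod (U x))\<^sup>2 = (cmod (V x))\<^sup>2"
      using AE by eventually_elim simp
  qed
  then have "integrable lebesgue (\<lambda>x. indicator \<Omega> x *\<^sub>R (cmod (V x))\<^sup>2)"
    using \<Omega> by (simp add: integrable_restrict_space)
  moreover have "(\<lambda>x. indicator \<Omega> x *\<^sub>R (cmod (V x))\<^sup>2) = (\<lambda>x. (cmod (V x))\<^sup>2)"
    using K(2) by (auto simp: V_def fun_eq_iff)
  ultimately have "integrable lborel (\<lambda>x. (cmod (V x))\<^sup>2)"
    using integrable_completion[of "\<lambda>x. (cmod (V x))\<^sup>2" lborel] by simp
  then have "square_integrable V" using V by (simp add: square_integrable_def)
  then show thesis using that K AE by (auto simp: V_def)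
qed

text \<open>Both sides equal the Lebesgue integral of \<open>H\<close> extended by \<open>0\<close>,
  because \<open>h\<close> vanishes outside \<Omega>; measurability of the extension is inherited
  from \<open>h\<close>.\<close>

lemma integral_lebesgue_on_representative:
  fixes h H :: "'a::euclidean_space \<Rightarrow> complex"
  assumes "open \<Omega>" "h \<in> borel_measurable borel" "K \<subseteq> \<Omega>" "\<And>x. x \<notin> K \<Longrightarrow> h x = 0"
    and "AE x in lebesgue_on \<Omega>. H x = h x"
  shows "(LINT x|lebesgue_on \<Omega>. H x) = (LINT x|lborel. h x)"
proof -
  have \<Omega>: "\<Omega> \<in> sets lebesgue" using assms(1) by simp
  have h: "h \<in> borel_measurable lebesgue" using assms(2) by (intro measurable_completion) simp
  have "AE x in lebesgue. x \<in> \<Omega> \<longrightarrow> H x = h x"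
    using assms(5) \<Omega> by (simp add: AE_restrict_space_iff)
  then have AE: "AE x in lebesgue. h x = indicator \<Omega> x *\<^sub>R H x"
    by eventually_elim (use assms(3,4) in \<open>auto simp: indicator_def\<close>)
  have "(LINT x|lebesgue_on \<Omega>. H x) = (LINT x|lebesgue. indicator \<Omega> x *\<^sub>R H x)"
    using \<Omega> by (simp add: integral_restrict_space)
  also have "\<dots> = (LINT x|lebesgue. h x)"
    using borel_measurable_AE[OF h AE] h AE by (intro integral_cong_AE) auto
  also have "\<dots> = (LINT x|lborel. h x)"
    using assms(2) by (intro integral_completion) simp
  finally show ?thesis .
qed

lemma continuous_on_laplacian: "smooth_c \<phi> \<Longrightarrow> continuous_on A (laplacian_c \<phi>)"
  unfolding laplacian_c_def [abs_def]
  by (intro continuous_intros smooth_c_continuous smooth_c_pderiv)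

lemma continuous_on_radial_deriv: "smooth_c \<phi> \<Longrightarrow> continuous_on A (radial_deriv_c \<phi>)"
  unfolding radial_deriv_c_def [abs_def]
  by (intro continuous_intros smooth_c_continuous smooth_c_pderiv)

text \<open>Only the terms in the unknown are transferred to the whole space. The source term stays
  as it is, being common to both solutions.\<close>

lemma very_weak_solution_representative:
  fixes \<Omega> :: "(real^'n::finite) set"
  assumes sol: "very_weak_solution \<Omega> m a b c F U" and \<Omega>: "open \<Omega>" and \<phi>: "test_fun \<Omega> \<phi>"
    and K: "K \<subseteq> \<Omega>" "\<And>x. x \<notin> K \<Longrightarrow> V x = 0" and V: "square_integrable V"
    and AE: "AE x in lebesgue_on \<Omega>. U x = V x"
  shows "Re (LINT x|lborel. V x * cnj (- laplacian_c \<phi> x))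
      + Re (LINT x|lborel. (- \<i> * of_real a * nonlin m (V x) - \<i> * b * V x) * cnj (\<phi> x))
      + Re (\<i> * of_real c * (- (LINT x|lborel. V x * cnj (of_nat CARD('n) * \<phi> x + radial_deriv_c \<phi> x))))
      = Re (LINT x|lebesgue_on \<Omega>. F x * cnj (\<phi> x))"
proof -
  have s: "smooth_c \<phi>" using \<phi> by (simp add: test_fun_def)
  note [measurable] = borel_measurable_continuous_onI[OF smooth_c_continuous[OF s]]
    borel_measurable_continuous_onI[OF continuous_on_laplacian[OF s]]
    borel_measurable_continuous_onI[OF continuous_on_radial_deriv[OF s]]
  have [measurable]: "V \<in> borel_measurable borel" using V by auto
  have eq: "(LINT x|lebesgue_on \<Omega>. U x * cnj (- laplacian_c \<phi> x)) = (LINT x|lborel. V x * cnj (- laplacian_c \<phi> x))"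
    "(LINT x|lebesgue_on \<Omega>. (- \<i> * of_real a * nonlin m (U x) - \<i> * b * U x) * cnj (\<phi> x))
      = (LINT x|lborel. (- \<i> * of_real a * nonlin m (V x) - \<i> * b * V x) * cnj (\<phi> x))"
    "(LINT x|lebesgue_on \<Omega>. U x * cnj (of_nat CARD('n) * \<phi> x + radial_deriv_c \<phi> x))
      = (LINT x|lborel. V x * cnj (of_nat CARD('n) * \<phi> x + radial_deriv_c \<phi> x))"
    by (rule integral_lebesgue_on_representative[OF \<Omega> _ K(1)];
        use AE K(2) in \<open>auto simp: nonlin_def elim!: eventually_mono\<close>)+
  show ?thesis
    using sol[unfolded very_weak_solution_def, THEN conjunct2, rule_format, OF \<phi>] unfolding eq .
qed

theorem theorem3p4:
  fixes \<Omega> :: "(real^'n::finite) set" and m a c :: real and b :: complex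
    and F U1 U2 :: "real^'n \<Rightarrow> complex"
  assumes "open \<Omega>" and "\<Omega> \<noteq> {}"
    and "0 < m" and "m < 1"
    and "a > 0" and "Re b \<ge> 0" and "c \<ge> 0"
    and "L2_on \<Omega> F"
    and "L2c_on \<Omega> U1" and "very_weak_solution \<Omega> m a b c F U1"
    and "L2c_on \<Omega> U2" and "very_weak_solution \<Omega> m a b c F U2"
  shows "AE x in lebesgue_on \<Omega>. U1 x = U2 x"
proof -
  obtain K1 V1 where K1: "compact K1" "K1 \<subseteq> \<Omega>"
    and V1: "square_integrable V1" and V1K1: "\<And>x. x \<notin> K1 \<Longrightarrow> V1 x = 0" and AE1: "AE x in lebesgue_on \<Omega>. U1 x = V1 x"
    using L2c_on_borel_representative[OF assms(1,9)] by blast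
  obtain K2 V2 where K2: "compact K2" "K2 \<subseteq> \<Omega>"
    and V2: "square_integrable V2" and V2K2: "\<And>x. x \<notin> K2 \<Longrightarrow> V2 x = 0" and AE2: "AE x in lebesgue_on \<Omega>. U2 x = V2 x"
    using L2c_on_borel_representative[OF assms(1,11)] by blast
  define K where "K = K1 \<union> K2"
  have K: "compact K" "K \<subseteq> \<Omega>" and V1K: "\<And>x. x \<notin> K \<Longrightarrow> V1 x = 0" and V2K: "\<And>x. x \<notin> K \<Longrightarrow> V2 x = 0"
    using K1 K2 V1K1 V2K2 by (auto simp: K_def)
  have N: "square_integrable (\<lambda>x. nonlin m (V x))" "nonlin m 0 = 0"
    if "square_integrable V" "\<And>x. x \<notin> K \<Longrightarrow> V x = 0" for V
    using square_integrable_nonlin[OF assms(3,4) that(1) K(1) that(2)] by (auto simp: nonlin_def)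
  define u where "u x = V1 x - V2 x" for x
  define g where "g x = nonlin m (V1 x) - nonlin m (V2 x)" for x
  have u: "square_integrable u" and g: "square_integrable g"
    using V1 V2 N[OF V1 V1K] N[OF V2 V2K] by (auto simp: u_def [abs_def] g_def [abs_def] intro: square_integrable_diff)
  have uK: "u x = 0" and gK: "g x = 0" if "x \<notin> K" for x
    using that V1K V2K by (auto simp: u_def g_def)
  have V1K': "\<forall>x. x \<notin> K \<longrightarrow> V1 x = 0" and V2K': "\<forall>x. x \<notin> K \<longrightarrow> V2 x = 0"
    using V1K V2K by auto
  \<comment> \<open>Integrals of differences split only for integrable functions, so each pairing is
    checked before the two equations are subtracted.\<close>
  have int: "integrable lborel (\<lambda>x. V x * cnj (\<psi> x))" "integrable lborel (\<lambda>x. nonlin m (V x) * cnj (\<psi> x))"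
    if V: "square_integrable V" "\<forall>x. x \<notin> K \<longrightarrow> V x = 0" and \<psi>: "continuous_on UNIV \<psi>" for V \<psi>
  proof -
    have c: "continuous_on UNIV (\<lambda>x. cnj (\<psi> x))" using \<psi> by (intro continuous_intros)
    show "integrable lborel (\<lambda>x. V x * cnj (\<psi> x))"
      by (rule integrable_mult_continuous[OF integrable_square_integrable[OF V(1) K(1) V(2)[rule_format]] K(1) V(2)[rule_format] c])
    show "integrable lborel (\<lambda>x. nonlin m (V x) * cnj (\<psi> x))"
      by (rule integrable_mult_continuous[OF integrable_square_integrable[OF N(1)[OF V(1) V(2)[rule_format]] K(1)] K(1) _ c])
        (simp_all add: V(2) N(2)[OF V(1) V(2)[rule_format]])
  qed
  have energy: "a * Re (LINT x|lborel. g x * cnj (u x))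
    + (Re b + c * CARD('n) / 2) * (LINT x|lborel. (cmod (u x))\<^sup>2) = 0"
  proof (rule energy_identity[OF u g K(1) uK gK _ assms(1) K(2)])
    fix \<phi> assume \<phi>: "test_fun \<Omega> \<phi>"
    have s: "smooth_c \<phi>" using \<phi> by (simp add: test_fun_def)
    define A where "A V = (LINT x|lborel. V x * cnj (- laplacian_c \<phi> x))" for V
    define B where "B V = (LINT x|lborel. (- \<i> * of_real a * nonlin m (V x) - \<i> * b * V x) * cnj (\<phi> x))" for V
    define R where "R V = (LINT x|lborel. V x * cnj (of_nat CARD('n) * \<phi> x + radial_deriv_c \<phi> x))" for V
    have cA: "continuous_on UNIV (\<lambda>x. - laplacian_c \<phi> x)"
      and cR: "continuous_on UNIV (\<lambda>x. of_nat CARD('n) * \<phi> x + radial_deriv_c \<phi> x)"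
      by (intro continuous_intros continuous_on_laplacian continuous_on_radial_deriv smooth_c_continuous s)+
    note cB = smooth_c_continuous[OF s, of UNIV]
    have 1: "(LINT x|lborel. u x * cnj (- laplacian_c \<phi> x)) = A V1 - A V2"
      unfolding A_def Bochner_Integration.integral_diff[OF int(1)[OF V1 V1K' cA] int(1)[OF V2 V2K' cA], symmetric]
      by (intro Bochner_Integration.integral_cong) (simp_all add: u_def algebra_simps)
    have iB: "integrable lborel (\<lambda>x. (- \<i> * of_real a * nonlin m (V x) - \<i> * b * V x) * cnj (\<phi> x))"
      if "square_integrable V" "\<forall>x. x \<notin> K \<longrightarrow> V x = 0" for V
    proof -
      have "integrable lborel (\<lambda>x. (- \<i> * of_real a) * (nonlin m (V x) * cnj (\<phi> x)) - (\<i> * b) * (V x * cnj (\<phi> x)))"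
        using int[OF that cB] by (intro Bochner_Integration.integrable_diff integrable_mult_right)
      then show ?thesis by (simp add: algebra_simps)
    qed
    have 2: "(LINT x|lborel. (- \<i> * of_real a * g x - \<i> * b * u x) * cnj (\<phi> x)) = B V1 - B V2"
      unfolding B_def Bochner_Integration.integral_diff[OF iB[OF V1 V1K'] iB[OF V2 V2K'], symmetric]
      by (intro Bochner_Integration.integral_cong) (simp_all add: u_def g_def algebra_simps)
    have 3: "(LINT x|lborel. u x * cnj (of_nat CARD('n) * \<phi> x + radial_deriv_c \<phi> x)) = R V1 - R V2"
      unfolding R_def Bochner_Integration.integral_diff[OF int(1)[OF V1 V1K' cR] int(1)[OF V2 V2K' cR], symmetric]
      by (intro Bochner_Integration.integral_cong) (simp_all add: u_def algebra_simps)
    \<comment> \<open>Both instances have the same right-hand side, the pairing of \<open>F\<close>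
      with \<open>\<phi>\<close>, which drops out on subtraction.\<close>
    note e1 = very_weak_solution_representative[OF assms(10,1) \<phi> K(2) V1K V1 AE1, folded A_def B_def R_def]
    note e2 = very_weak_solution_representative[OF assms(12,1) \<phi> K(2) V2K V2 AE2, folded A_def B_def R_def]
    show "Re (LINT x|lborel. u x * cnj (- laplacian_c \<phi> x))
      + Re (LINT x|lborel. (- \<i> * of_real a * g x - \<i> * b * u x) * cnj (\<phi> x))
      + Re (\<i> * of_real c * (- (LINT x|lborel. u x * cnj (of_nat CARD('n) * \<phi> x + radial_deriv_c \<phi> x)))) = 0"
      unfolding 1 2 3 using e1 e2 by (simp add: algebra_simps)
  qed
  define p where "p x = Re (g x * cnj (u x))" for x
  have mono: "0 \<le> p x" and strict: "p x = 0 \<Longrightarrow> V1 x = V2 x" for x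
    using nonlin_strict_mono[OF assms(3), of "V1 x" "V2 x"] unfolding p_def g_def u_def
    by (cases "V1 x = V2 x"; simp)+
  have ip: "integrable lborel p"
    unfolding p_def [abs_def] by (rule integrable_Re) (rule integrable_mult_cnj[OF g u])
  have Re: "Re (LINT x|lborel. g x * cnj (u x)) = (LINT x|lborel. p x)"
    unfolding p_def by (rule integral_Re[symmetric]) (rule integrable_mult_cnj[OF g u])
  have "0 \<le> a * (LINT x|lborel. p x)"
    using mono assms(5) by (intro mult_nonneg_nonneg integral_nonneg_AE) auto
  moreover have "0 \<le> (Re b + c * CARD('n) / 2) * (LINT x|lborel. (cmod (u x))\<^sup>2)"
    using assms(6,7) by (intro mult_nonneg_nonneg integral_nonneg_AE) auto
  \<comment> \<open>Two nonnegative numbers with sum \<open>0\<close> both vanish. Since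
    \<open>a > 0\<close>, the integral of \<open>p\<close> is \<open>0\<close>, and strict
    monotonicity turns \<open>p x = 0\<close> into equality of the two representatives at
    \<open>x\<close>.\<close>
  ultimately have "a * (LINT x|lborel. p x) = 0"
    using energy unfolding Re by linarith
  then have "(LINT x|lborel. p x) = 0"
    using assms(5) by simp
  then have "AE x in lborel. p x = 0"
    using mono ip by (simp add: integral_nonneg_eq_0_iff_AE)
  then have "AE x in lborel. V1 x = V2 x"
    by eventually_elim (rule strict)
  then have "AE x in lebesgue_on \<Omega>. V1 x = V2 x"
    using assms(1) by (intro AE_lebesgue_on_lborel) auto
  with AE1 AE2 show ?thesis by eventually_elim simp
qed

end
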